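(* Every positive real number $x\in\mathbb{Z}+[1/2,1]$ can be represented as a product of two continued fractions whose odd-order partial quotients are all equal to $1$: \[ x=[a_0;1,a_2,1,a_4,1,a_6,\ldots]\cdot[b_0;1,b_2,1,b_4,1,b_6,\ldots], \] where $a_0,b_0$ are nonnegative integers and $a_i,b_i$ are positive integers for $i>0$.
   Context: $[c_0;c_1,c_2,\ldots]$ denotes the (finite or infinite) regular continued fraction $c_0+\cfrac{1}{c_1+\cfrac{1}{c_2+\cdots}}$ with $c_0$ a nonnegative integer and $c_i$ positive integers for $i\ge1$; the representation is allowed to be a finite continued fraction. *)

theory Defs
  imports Complex_Main "HOL-Library.Extended_Nat"
begin

text \<open>\<open>cf_convergent c n\<close> is the finite continued fraction \<open>[c 0; c 1, \<dots>, c n]\<close>.\<close>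

primrec cf_convergent :: "(nat \<Rightarrow> nat) \<Rightarrow> nat \<Rightarrow> real" where
  "cf_convergent c 0 = real (c 0)"
| "cf_convergent c (Suc n) = real (c 0) + 1 / cf_convergent (\<lambda>i. c (Suc i)) n"

text \<open>
  \<open>regular_cf c N y\<close>: the sequence \<open>c\<close>, read up to and including index \<open>N\<close>, is a regular
  continued fraction with value \<open>y\<close>. It is finite with last partial quotient \<open>c n\<close>
  (possibly equal to 1) for \<open>N = enat n\<close>, and infinite for \<open>N = \<infinity>\<close>. Entries of \<open>c\<close> beyond
  a finite \<open>N\<close> play no role. The first partial quotient \<open>c 0\<close> may be zero.
\<close>

definition regular_cf :: "(nat \<Rightarrow> nat) \<Rightarrow> enat \<Rightarrow> real \<Rightarrow> bool" where
  "regular_cf c N y \<longleftrightarrow>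
     (\<forall>i>0. enat i \<le> N \<longrightarrow> c i > 0) \<and>
     (case N of
        enat n \<Rightarrow> y = cf_convergent c n
      | \<infinity> \<Rightarrow> cf_convergent c \<longlonglongrightarrow> y)"

definition odd_quotients_one :: "(nat \<Rightarrow> nat) \<Rightarrow> enat \<Rightarrow> bool" where
  "odd_quotients_one c N \<longleftrightarrow> (\<forall>i. odd i \<and> enat i \<le> N \<longrightarrow> c i = 1)"

end

theory Submission
  imports Defs "HOL-Analysis.Analysis"
begin

text \<open>
  Since \<open>a + 1/(1 + 1/z) = a + 1 - 1/(z + 1)\<close>, the continued fraction \<open>[a\<^sub>0; 1, a\<^sub>2, 1, a\<^sub>4, \<dots>]\<close>
  equals \<open>a\<^sub>0 + 1 - s\<close> with the minus continued fraction \<open>s = 1/(m\<^sub>1 - 1/(m\<^sub>2 - \<dots>))\<close>, where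
  \<open>m\<^sub>i = a\<^sub>2\<^sub>i + 2 \<ge> 3\<close>. For \<open>x = l + 1 - h\<close> with \<open>0 < h \<le> 1/2\<close> it remains to find two such numbers with
  \<open>(1 - s) (l + 1 - t) = x\<close>, that is, a point of this kind on the curve \<open>(l + 1) s + t - s t = h\<close>.

  The substitution \<open>s = 1/(m - s')\<close> maps a curve \<open>b s + g t - k s t = h\<close> to a curve of the same form
  whose coefficients depend linearly on \<open>k\<close>, \<open>b\<close>, \<open>g\<close>, \<open>h\<close>, and similarly for \<open>t\<close>. There is a polyhedral cone of
  coefficient vectors from which suitable digits always lead back to the cone, up to exchanging the
  coordinates. Iterating gives zeros in nested compact sets, hence an exact solution. When \<open>h\<close> is
  small compared with \<open>b g - k h\<close>, the digits are found by a lattice point argument; this also brings the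
  initial curve into the cone. Otherwise only linear inequalities are involved, and finitely many
  digits suffice.
\<close>

section \<open>Minus continued fractions\<close>

text \<open>Membership means that digits can be split off forever. The bounds on the tail are
  essential: (3 + sqrt 5)/2 also satisfies s = 1/(3 - s), but is not the value of the expansion with
  all digits 3.\<close>

coinductive minus_cf :: "real \<Rightarrow> bool" where
  "minus_cf s \<Longrightarrow> 0 \<le> s \<Longrightarrow> s \<le> 1/2 \<Longrightarrow> 3 \<le> m \<Longrightarrow> minus_cf (1 / (real m - s))"

lemma cf_convergent_ge: "real (c 0) \<le> cf_convergent c n"
proof (induction n arbitrary: c)
  case (Suc n)
  have "0 \<le> real (c (Suc 0))" by simp
  also have "\<dots> \<le> cf_convergent (\<lambda>i. c (Suc i)) n" using Suc[of "\<lambda>i. c (Suc i)"] by simp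
  finally show ?case by simp
qed simp

text \<open>Two steps of the recursion apply w -> 1 - 1/(w + 1) up to a shift, which contracts by
  the factor 1/4 on w >= 1; hence an induction in steps of two, with error halving per index. Here
  \<open>z i\<close> is the intended value of the tail starting at index
  \<open>2 * i\<close>.\<close>

lemma cf_convergent_error:
  fixes c :: "nat \<Rightarrow> nat" and z :: "nat \<Rightarrow> real"
  assumes odd: "\<And>i. odd i \<Longrightarrow> c i = 1"
    and pos: "\<And>i. i > 0 \<Longrightarrow> c i > 0"
    and z: "\<And>i. z i = real (c (2 * i)) + 1 - 1 / (z (Suc i) + 1)"
    and z_bounds: "\<And>i. real (c (2 * i)) \<le> z i" "\<And>i. z i \<le> real (c (2 * i)) + 1"
  shows "\<bar>cf_convergent (\<lambda>j. c (2 * i + j)) n - z i\<bar> \<le> 2 * (1/2) ^ n"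
proof (induction n arbitrary: i rule: induct_nat_012)
  case 0
  show ?case using z_bounds[of i] by (simp add: abs_le_iff)
next
  case 1
  have "c (Suc (2 * i)) = 1" using odd[of "Suc (2 * i)"] by simp
  then show ?case using z_bounds[of i] by (simp add: abs_le_iff)
next
  case (ge2 n)
  define w where "w = cf_convergent (\<lambda>j. c (2 * Suc i + j)) n"
  have c1: "c (Suc (2 * i)) = 1" using odd[of "Suc (2 * i)"] by simp
  have shift: "(\<lambda>j. c (2 * i + Suc (Suc j))) = (\<lambda>j. c (2 * Suc i + j))" by simp
  have conv: "cf_convergent (\<lambda>j. c (2 * i + j)) (Suc (Suc n)) = real (c (2 * i)) + 1 / (1 + 1 / w)"
    unfolding w_def shift[symmetric] by (simp add: c1)
  have c2: "1 \<le> real (c (2 * Suc i))" using pos[of "2 * Suc i"] by simp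
  have w1: "1 \<le> w" using cf_convergent_ge[of "\<lambda>j. c (2 * Suc i + j)" n] c2 unfolding w_def by simp
  have z1: "1 \<le> z (Suc i)" using z_bounds(1)[of "Suc i"] c2 by linarith
  have "1 / (1 + 1 / w) = 1 - 1 / (w + 1)" using w1 by (simp add: field_simps)
  then have "cf_convergent (\<lambda>j. c (2 * i + j)) (Suc (Suc n)) - z i
      = 1 / (z (Suc i) + 1) - 1 / (w + 1)" using conv z[of i] by linarith
  also have "\<dots> = (w - z (Suc i)) / ((z (Suc i) + 1) * (w + 1))"
    using w1 z1 by (simp add: divide_simps)
  finally have "\<bar>cf_convergent (\<lambda>j. c (2 * i + j)) (Suc (Suc n)) - z i\<bar>
      = \<bar>w - z (Suc i)\<bar> / ((z (Suc i) + 1) * (w + 1))" using w1 z1 by (simp add: abs_mult)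
  also have "\<dots> \<le> \<bar>w - z (Suc i)\<bar> / (2 * 2)"
    using w1 z1 by (intro divide_left_mono mult_mono) auto
  also have "\<dots> \<le> 2 * (1/2) ^ n / (2 * 2)"
    using ge2(1)[of "Suc i"] unfolding w_def by (intro divide_right_mono) auto
  finally show ?case by simp
qed

text \<open>Unfolding gives digits \<open>m (\<sigma> i)\<close> and tails
  \<open>\<sigma> i\<close>. With \<open>z i\<close> set to
  \<open>a (2 * i) + 1 - \<sigma> i\<close>, the relation between consecutive tails is exactly the
  recursion for \<open>z\<close> in \<open>cf_convergent_error\<close>, since z (i+1) + 1 is the
  denominator of \<open>\<sigma> i\<close>.\<close>

lemma minus_cf_regular:
  assumes "minus_cf s"
  shows "\<exists>a. regular_cf a \<infinity> (real (Suc p) - s) \<and> odd_quotients_one a \<infinity>"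
proof -
  have "\<forall>s. \<exists>m s'. minus_cf s \<longrightarrow> minus_cf s' \<and> 0 \<le> s' \<and> s' \<le> 1/2 \<and> 3 \<le> m \<and> s = 1 / (real m - s')"
    by (metis minus_cf.cases)
  then obtain m r where mr: "\<And>s. minus_cf s \<Longrightarrow>
      minus_cf (r s) \<and> 0 \<le> r s \<and> r s \<le> 1/2 \<and> 3 \<le> m s \<and> s = 1 / (real (m s) - r s)"
    by metis
  define \<sigma> where "\<sigma> i = (r ^^ i) s" for i
  have cf: "minus_cf (\<sigma> i)" for i
    by (induction i) (use assms mr in \<open>auto simp: \<sigma>_def\<close>)
  have \<sigma>Suc: "\<sigma> (Suc i) = r (\<sigma> i)" for i by (simp add: \<sigma>_def)
  have step: "3 \<le> m (\<sigma> i)" "\<sigma> i = 1 / (real (m (\<sigma> i)) - \<sigma> (Suc i))" for i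
    using mr[OF cf] by (auto simp: \<sigma>Suc)
  have bound: "0 \<le> \<sigma> i \<and> \<sigma> i \<le> 1/2" for i
  proof -
    have "0 \<le> \<sigma> (Suc i)" "\<sigma> (Suc i) \<le> 1/2" using mr[OF cf[of i]] by (auto simp: \<sigma>Suc)
    moreover have "3 \<le> real (m (\<sigma> i))" using step(1)[of i] by simp
    ultimately have "2 \<le> real (m (\<sigma> i)) - \<sigma> (Suc i)" by linarith
    then show ?thesis by (subst (1 2) step(2)) (simp add: divide_simps)
  qed
  \<comment> \<open>The digit \<open>m (\<sigma> i)\<close> yields the quotient at index
    \<open>2 * i + 2\<close>, lowered by 2, so digits at least 3 make it positive.\<close>
  define a where "a i = (if odd i then 1 else if i = 0 then p else m (\<sigma> (i div 2 - 1)) - 2)" for i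
  define z where "z i = real (a (2 * i)) + 1 - \<sigma> i" for i
  have even_a: "real (a (2 * Suc i)) = real (m (\<sigma> i)) - 2" for i
    using step(1)[of i] by (simp add: a_def of_nat_diff)
  have a_pos: "a i > 0" if "i > 0" for i
    using that step(1)[of "i div 2 - 1"] by (auto simp: a_def)
  have err: "\<bar>cf_convergent (\<lambda>j. a (2 * 0 + j)) n - z 0\<bar> \<le> 2 * (1/2) ^ n" for n
  proof (rule cf_convergent_error)
    show "odd i \<Longrightarrow> a i = 1" for i by (simp add: a_def)
    show "i > 0 \<Longrightarrow> a i > 0" for i by (rule a_pos)
    show "z i = real (a (2 * i)) + 1 - 1 / (z (Suc i) + 1)" for i
      unfolding z_def even_a using step(2)[of i] by (simp add: algebra_simps)
    show "real (a (2 * i)) \<le> z i" "z i \<le> real (a (2 * i)) + 1" for i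
      using bound[of i] by (auto simp: z_def)
  qed
  have "(\<lambda>n. 2 * (1/2) ^ n :: real) \<longlonglongrightarrow> 0"
    using tendsto_mult_right_zero[OF LIMSEQ_realpow_zero[of "1/2 :: real"]] by simp
  then have "(\<lambda>n. cf_convergent a n - z 0) \<longlonglongrightarrow> 0"
    by (rule Lim_null_comparison[rotated]) (use err in auto)
  then have "cf_convergent a \<longlonglongrightarrow> z 0" by (simp add: LIM_zero_cancel)
  moreover have "z 0 = real (Suc p) - s" by (simp add: z_def a_def \<sigma>_def)
  moreover note a_pos
  ultimately have "regular_cf a \<infinity> (real (Suc p) - s)" by (simp add: regular_cf_def)
  moreover have "odd_quotients_one a \<infinity>" by (simp add: odd_quotients_one_def a_def)
  ultimately show ?thesis by blast
qed

section \<open>Bilinear curves\<close>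

definition curve :: "real \<Rightarrow> real \<Rightarrow> real \<Rightarrow> real \<Rightarrow> real \<Rightarrow> real \<Rightarrow> real" where
  "curve k b g h s t = b * s + g * t - k * s * t - h"

lemma curve_swap: "curve k g b h t s = curve k b g h s t"
  by (simp add: curve_def algebra_simps)

lemma curve_split_left:
  assumes "m \<noteq> s"
  shows "curve g h (m * g - k) (m * h - b) s t = (m - s) * curve k b g h (1 / (m - s)) t"
proof -
  have "(m - s) * (1 / (m - s)) = 1" using assms by simp
  then show ?thesis unfolding curve_def by algebra
qed

text \<open>Clear both denominators. This substitution and the one-sided one both preserve the
  determinant \<open>b * g - k * h\<close>, which makes it the natural quantity to compare with
  h^2.\<close>

lemma curve_split_both:
  assumes "m \<noteq> s" "n \<noteq> t"
  shows "curve h (n * h - g) (m * h - b) (m * (n * h - g) - (n * b - k)) s t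
    = (m - s) * (n - t) * curve k b g h (1 / (m - s)) (1 / (n - t))"
proof -
  have "(m - s) * (1 / (m - s)) = 1" "(n - t) * (1 / (n - t)) = 1" using assms by simp_all
  then show ?thesis unfolding curve_def by algebra
qed

section \<open>Points with many digits\<close>

text \<open>
  The bound 200 on the digits only serves compactness; \<open>region_imp_step\<close> needs no larger ones.
\<close>

primrec survivors :: "nat \<Rightarrow> real set" where
  "survivors 0 = {0..1/2}"
| "survivors (Suc n) = (\<Union>m\<in>{3..200::nat}. (\<lambda>s. 1 / (real m - s)) ` survivors n)"

lemma inverse_diff_bounds:
  fixes s :: real assumes "0 \<le> s" "s \<le> 1/2" "3 \<le> (m::nat)"
  shows "0 \<le> 1 / (real m - s)" "1 / (real m - s) \<le> 1/2" "real m \<noteq> s"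
proof -
  have "2 \<le> real m - s" using assms by linarith
  then show "0 \<le> 1 / (real m - s)" "1 / (real m - s) \<le> 1/2" "real m \<noteq> s"
    by (auto simp: divide_simps)
qed

lemma survivors_bounds: "s \<in> survivors n \<Longrightarrow> 0 \<le> s \<and> s \<le> 1/2"
proof (induction n arbitrary: s)
  case (Suc n)
  then obtain m s' where "m \<in> {3..200::nat}" "s' \<in> survivors n" "s = 1 / (real m - s')" by auto
  then show ?case using inverse_diff_bounds[of s' m] Suc.IH[of s'] by auto
qed simp

lemma survivorsI:
  "s \<in> survivors n \<Longrightarrow> m \<in> {3..200::nat} \<Longrightarrow> 1 / (real m - s) \<in> survivors (Suc n)"
  by auto

lemma survivors_Suc_subset: "survivors (Suc n) \<subseteq> survivors n"
proof (induction n)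
  case 0
  show ?case using survivors_bounds[of _ "Suc 0"] by auto
next
  case (Suc n)
  then show ?case by (simp only: survivors.simps(2)) blast
qed

lemma survivors_antimono: "n \<le> n' \<Longrightarrow> survivors n' \<subseteq> survivors n"
  by (rule lift_Suc_antimono_le[of survivors]) (rule survivors_Suc_subset)

lemma compact_survivors: "compact (survivors n)"
proof (induction n)
  case (Suc n)
  have "continuous_on (survivors n) (\<lambda>s. 1 / (real m - s))" if "m \<in> {3..200::nat}" for m
    using that survivors_bounds inverse_diff_bounds(3) by (intro continuous_intros) force+
  then show ?case using Suc by (simp only: survivors.simps(2)) (intro compact_UN compact_continuous_image; simp)
qed simp

text \<open>A first digit \<open>m\<close> forces the tail \<open>real m - 1 / s\<close>, but a
  priori the digit depends on the depth. As only finitely many digits are allowed, one of them works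
  for infinitely many depths, hence for all by monotonicity, and the coinduction continues with its
  tail.\<close>

lemma survivors_minus_cf:
  assumes "\<And>n. s \<in> survivors n"
  shows "minus_cf s"
proof -
  have "\<forall>n. s \<in> survivors n" using assms by blast
  then show ?thesis
  proof (coinduction arbitrary: s)
    case minus_cf
    have "\<exists>m\<in>{3..200::nat}. real m - 1 / s \<in> survivors n \<and> s = 1 / (real m - (real m - 1 / s))" for n
    proof -
      obtain m s' where m: "m \<in> {3..200::nat}" "s' \<in> survivors n" "s = 1 / (real m - s')"
        using minus_cf[rule_format, of "Suc n"] by auto
      have "1 / s = real m - s'" using m(3) by simp
      then have "s' = real m - 1 / s" by linarith
      then show ?thesis using m by metis
    qed
    then obtain m where m: "\<And>n. m n \<in> {3..200::nat}" "\<And>n. real (m n) - 1 / s \<in> survivors n"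
      and s: "s = 1 / (1 / s)" by (metis diff_diff_eq2 add_diff_cancel_left')
    have "finite (range m)" using m(1) by (meson finite_atLeastAtMost finite_subset image_subsetI)
    then obtain m0 where m0: "infinite {n. m n = m0}"
      using pigeonhole_infinite[of UNIV m] by auto
    have mem: "real m0 - 1 / s \<in> survivors n" for n
    proof -
      obtain n' where "n' \<ge> n" "m n' = m0" using m0 by (metis (mono_tags) finite_nat_set_iff_bounded_le mem_Collect_eq nat_le_linear)
      moreover have "survivors n' \<subseteq> survivors n"
        using \<open>n' \<ge> n\<close> by (rule survivors_antimono)
      ultimately show ?thesis using m(2)[of n'] by auto
    qed
    have "3 \<le> m0" using m(1) m0 by (metis (mono_tags, lifting) atLeastAtMost_iff finite.emptyI Collect_empty_eq)
    moreover have "s = 1 / (real m0 - (real m0 - 1 / s))" using s by simp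
    moreover have "0 \<le> real m0 - 1 / s \<and> real m0 - 1 / s \<le> 1/2" using mem[of 0] by simp
    ultimately show ?case using mem by blast
  qed
qed


text \<open>The zeros at each depth form a nested sequence of nonempty compact subsets of the plane;
  a common point has both coordinates in every \<open>survivors n\<close>.\<close>

lemma survivors_solution:
  assumes "\<And>n. \<exists>s\<in>survivors n. \<exists>t\<in>survivors n. curve k b g h s t = 0"
  shows "\<exists>s t. minus_cf s \<and> minus_cf t \<and> curve k b g h s t = 0"
proof -
  define Z where "Z n = (survivors n \<times> survivors n) \<inter> {p. curve k b g h (fst p) (snd p) = 0}" for n
  have "\<Inter> (range Z) \<noteq> {}"
  proof (rule compact_nest)
    have "closed {p. curve k b g h (fst p) (snd p) = 0}"
      unfolding curve_def by (intro closed_Collect_eq continuous_intros)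
    then show "compact (Z n)" for n
      unfolding Z_def by (intro compact_Int_closed compact_Times compact_survivors)
    show "Z n \<noteq> {}" for n using assms[of n] by (force simp: Z_def)
    show "Z n \<subseteq> Z n'" if "n' \<le> n" for n n'
      using survivors_antimono[OF that] by (auto simp: Z_def)
  qed
  then obtain p where "\<And>n. p \<in> Z n" by blast
  then have "minus_cf (fst p)" "minus_cf (snd p)" "curve k b g h (fst p) (snd p) = 0"
    by (auto simp: Z_def mem_Times_iff intro!: survivors_minus_cf)
  then show ?thesis by blast
qed

section \<open>The invariant cone\<close>

text \<open>
  Let \<open>p = b - 19/50 k\<close> and \<open>q = g - 19/50 k\<close> be the partial derivatives of the curve function \<open>f\<close> at
  \<open>(c, c)\<close> with \<open>c = 19/50\<close>, which is slightly below the largest minus continued fraction \<open>(3 - sqrt 5)/2\<close>.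
  The rows say \<open>k \<le> 7/10 (p + q)\<close>, \<open>p \<le> 9 q\<close>, \<open>8 q \<le> 5 p\<close>, \<open>23/100 p \<le> q + 1/2 f(c, c)\<close> and
  \<open>f(1/50, 1/50) \<le> 0 \<le> f(c, c)\<close>. If \<open>f(c, c)\<close> is small and the slope \<open>q/p\<close> is below about \<open>1/4\<close> or above
  about \<open>5/8\<close>, the curve may fall into a gap, which is why the fourth row involves \<open>f(c, c)\<close>.
\<close>

definition region :: "real \<Rightarrow> real \<Rightarrow> real \<Rightarrow> real \<Rightarrow> bool" where
  "region k b g h \<longleftrightarrow>
     0 \<le> k \<and> 383 * k \<le> 175 * (b + g) \<and>
     76 * k + 25 * b \<le> 225 * g \<and>
     400 * g \<le> 57 * k + 250 * b \<and>
     912 * k + 100 * b + 1250 * h \<le> 2975 * g \<and>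
     50 * (b + g) \<le> k + 2500 * h \<and>
     361 * k + 2500 * h \<le> 950 * (b + g)"

text \<open>
  After splitting only the first coordinate, the second one has the longer range, so
  the roles of \<open>b\<close> and \<open>g\<close> are exchanged.
\<close>

definition region_step :: "real \<Rightarrow> real \<Rightarrow> real \<Rightarrow> real \<Rightarrow> bool" where
  "region_step k b g h \<longleftrightarrow>
     (\<exists>m\<in>{3..200::nat}. region g (real m * g - k) h (real m * h - b)) \<or>
     (\<exists>m\<in>{3..200::nat}. \<exists>n\<in>{3..200::nat}.
        let b' = real n * h - g; g' = real m * h - b;
            h' = real m * (real n * h - g) - (real n * b - k)
        in region h b' g' h' \<or> region h g' b' h')"

lemma region_step_one:
  assumes "m \<in> {3..200}" "region g (real m * g - k) h (real m * h - b)"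
  shows "region_step k b g h"
  using assms unfolding region_step_def by blast

lemma region_step_two:
  assumes "m \<in> {3..200}" "n \<in> {3..200}"
    "region h (real n * h - g) (real m * h - b) (real m * (real n * h - g) - (real n * b - k))"
  shows "region_step k b g h"
  using assms unfolding region_step_def Let_def by blast

lemma region_step_swap:
  assumes "m \<in> {3..200}" "n \<in> {3..200}"
    "region h (real m * h - b) (real n * h - g) (real m * (real n * h - g) - (real n * b - k))"
  shows "region_step k b g h"
  using assms unfolding region_step_def Let_def by blast

section \<open>Choice of digits for a large constant term\<close>

text \<open>
  The next three lemmas treat \<open>1/9 \<le> q/p \<le> 1/4\<close>, \<open>1/4 \<le> q/p \<le> 9/16\<close> and \<open>9/16 \<le> q/p\<close>; the last assumption
  bounds \<open>h\<close> from below (see \<open>large_imp_linear_bound\<close>). The case distinctions were found by computer: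
  every condition is a facet of the preimage of the cone under some choice of digits, and the
  facts used in a leaf are those occurring in Farkas certificates for its linear inequalities.
\<close>

lemma region_step_range0:
  assumes h0: "76 * k + 25 * b \<le> 225 * g"
    and h1: "200 * g \<le> 57 * k + 50 * b"
    and h2: "912 * k + 100 * b + 1250 * h \<le> 2975 * g"
    and h3: "400 * g \<le> 57 * k + 250 * b"
    and h4: "50 * b + 50 * g \<le> k + 2500 * h"
    and h5: "361 * k + 2500 * h \<le> 950 * b + 950 * g"
    and h6: "0 \<le> k"
    and h7: "383 * k \<le> 175 * b + 175 * g"
    and h8: "450 * b + 2700 * g \<le> 747 * k + 6250 * h"
  shows "region_step k b g h"
\<comment> \<open>This is f(1/50, 1/50) <= 0 for the curve obtained by splitting off the single
  digit 4.\<close>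
proof (cases "2500 * b + 199 * g \<le> 50 * k + 9950 * h")
  case c0: True
  show ?thesis
  proof (cases "2500 * b + 149 * g \<le> 50 * k + 7450 * h")
    case c1: True
    show ?thesis
    proof (cases "250 * k + 400 * h \<le> 807 * g")
      case c2: True
      show ?thesis using c1 c2 h1 h2 h5 h6 h7
        by - (rule region_step_one[where m=3]; simp add: region_def)
    next
      case c2: False
      show ?thesis using c2 h2 h5 h6 h7
        by - (rule region_step_two[where m=3 and n=3]; simp add: region_def)
    qed
  next
    case c1: False
    show ?thesis
    proof (cases "176 * g \<le> 25 * k + 225 * h")
      case c2: True
      show ?thesis using c0 c1 c2 h1 h2 h6 h7
        by - (rule region_step_one[where m=4]; simp add: region_def)
    next
      case c2: False
      show ?thesis
      proof (cases "1250 * k + 24137 * h \<le> 4525 * b + 6350 * g")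
        case c3: True
        show ?thesis using c0 c2 c3 h1 h7
          by - (rule region_step_two[where m=5 and n=6]; simp add: region_def)
      next
        case c3: False
        show ?thesis using c2 c3 h1 h7
          by - (rule region_step_two[where m=5 and n=5]; simp add: region_def)
      qed
    qed
  qed
next
  case c0: False
  show ?thesis
  \<comment> \<open>This is f(c, c) >= 0 after splitting with \<open>m = 9\<close> and
    \<open>n = 3\<close>: the coefficients are 2500 m - 950 at \<open>g\<close> and 2500 n - 950 at
    \<open>b\<close>. The facet f(1/50, 1/50) <= 0 for a pair of digits has 2500 m - 50 and 2500 n -
    50 instead.\<close>
  proof (cases "2500 * k + 56461 * h \<le> 6550 * b + 21550 * g")
    case c1: True
    show ?thesis
    proof (cases "7450 * b + 27450 * g \<le> 2500 * k + 81801 * h")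
      case c2: True
      show ?thesis
      proof (cases "7450 * b + 24950 * g \<le> 2500 * k + 74351 * h")
        case c3: True
        show ?thesis
        proof (cases "7450 * b + 22450 * g \<le> 2500 * k + 66901 * h")
          case c4: True
          show ?thesis
          proof (cases "250 * b \<le> 400 * g + 1107 * h")
            case c5: True
            show ?thesis
            proof (cases "1250 * k + 26637 * h \<le> 3850 * b + 8275 * g")
              case c6: True
              show ?thesis using c1 c4 c5 c6 h0 h1 h7
                by - (rule region_step_swap[where m=9 and n=3]; simp add: region_def)
            next
              case c6: False
              show ?thesis using c1 c6 h1 h7
                by - (rule region_step_swap[where m=8 and n=3]; simp add: region_def)
            qed
          next
            case c5: False
            show ?thesis
            proof (cases "251 * g \<le> 25 * k + 225 * h")
              case c6: True
              show ?thesis using c1 c4 c5 c6 h0 h6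
                by - (rule region_step_one[where m=7]; simp add: region_def)
            next
              case c6: False
              show ?thesis
              proof (cases "9950 * b + 19950 * g \<le> 2500 * k + 79401 * h")
                case c7: True
                show ?thesis
                proof (cases "250 * g + 2143 * h \<le> 400 * b")
                  case c8: True
                  show ?thesis using c5 c6 c7 c8 h0 h6
                    by - (rule region_step_two[where m=8 and n=4]; simp add: region_def)
                next
                  case c8: False
                  show ?thesis
                  proof (cases "1250 * k + 42037 * h \<le> 5775 * b + 8850 * g")
                    case c9: True
                    show ?thesis using c5 c6 c8 c9 h6
                      by - (rule region_step_two[where m=7 and n=7]; simp add: region_def)
                  next
                    case c9: False
                    show ?thesis using c5 c6 c9 h6
                      by - (rule region_step_two[where m=7 and n=6]; simp add: region_def)
                  qed
                qed
              next
                case c7: False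
                show ?thesis using c4 c5 c7 h0 h6
                  by - (rule region_step_two[where m=8 and n=5]; simp add: region_def)
              qed
            qed
          qed
        next
          case c4: False
          show ?thesis
          proof (cases "250 * b \<le> 400 * g + 1357 * h")
            case c5: True
            show ?thesis
            proof (cases "2500 * k + 63011 * h \<le> 6550 * b + 24050 * g")
              case c6: True
              show ?thesis using c3 c4 c5 c6 h0 h1 h7
                by - (rule region_step_swap[where m=10 and n=3]; simp add: region_def)
            next
              case c6: False
              show ?thesis
              proof (cases "12450 * b + 19950 * g \<le> 2500 * k + 99351 * h")
                case c7: True
                show ?thesis using c4 c6 c7 h0 h6
                  by - (rule region_step_two[where m=8 and n=5]; simp add: region_def)
              next
                case c7: False
                show ?thesis using c5 c6 c7 h0
                  by - (rule region_step_one[where m=7]; simp add: region_def)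
              qed
            qed
          next
            case c5: False
            show ?thesis
            proof (cases "14950 * b + 19950 * g \<le> 2500 * k + 119301 * h")
              case c6: True
              show ?thesis using c4 c5 c6 h0 h6
                by - (rule region_step_two[where m=8 and n=6]; simp add: region_def)
            next
              case c6: False
              show ?thesis
              proof (cases "250 * g + 2543 * h \<le> 400 * b")
                case c7: True
                show ?thesis
                proof (cases "9950 * b + 22450 * g \<le> 2500 * k + 89351 * h")
                  case c8: True
                  show ?thesis using c5 c7 c8 h0 h6
                    by - (rule region_step_two[where m=9 and n=4]; simp add: region_def)
                next
                  case c8: False
                  show ?thesis using c3 c5 c7 c8 h0 h6
                    by - (rule region_step_two[where m=9 and n=5]; simp add: region_def)
                qed
              next
                case c7: False
                show ?thesis using c3 c6 c7 h0 h6
                  by - (rule region_step_two[where m=8 and n=7]; simp add: region_def)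
              qed
            qed
          qed
        qed
      next
        case c3: False
        show ?thesis
        proof (cases "225 * g \<le> 25 * b + 324 * h")
          case c4: True
          show ?thesis
          proof (cases "2500 * k + 69561 * h \<le> 6550 * b + 26550 * g")
            case c5: True
            show ?thesis using c2 c3 c4 c5 h0 h1 h6
              by - (rule region_step_swap[where m=11 and n=3]; simp add: region_def)
          next
            case c5: False
            show ?thesis using c3 c5 h0 h6
              by - (rule region_step_two[where m=9 and n=5]; simp add: region_def)
          qed
        next
          case c4: False
          show ?thesis using c2 c4 h1 h7
            by - (rule region_step_swap[where m=8 and n=4]; simp add: region_def)
        qed
      qed
    next
      case c2: False
      show ?thesis
      proof (cases "17450 * b + 19950 * g \<le> 2500 * k + 139251 * h")
        case c3: True
        show ?thesis
        proof (cases "2500 * k + 126111 * h \<le> 16550 * b + 19050 * g")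
          case c4: True
          show ?thesis using c2 c3 c4 h0 h1 h7
            by - (rule region_step_two[where m=8 and n=7]; simp add: region_def)
        next
          case c4: False
          show ?thesis
          proof (cases "2500 * k + 87061 * h \<le> 9050 * b + 24050 * g")
            case c5: True
            show ?thesis
            proof (cases "9950 * b + 24950 * g \<le> 2500 * k + 99301 * h")
              case c6: True
              show ?thesis
              proof (cases "250 * b \<le> 400 * g + 957 * h")
                case c7: True
                show ?thesis using c5 c6 c7 h0 h1 h7 h8
                  by - (rule region_step_swap[where m=10 and n=4]; simp add: region_def)
              next
                case c7: False
                show ?thesis using c4 c5 c7 h8
                  by - (rule region_step_two[where m=8 and n=6]; simp add: region_def)
              qed
            next
              case c6: False
              show ?thesis
              proof (cases "9950 * b + 27450 * g \<le> 2500 * k + 109251 * h")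
                case c7: True
                show ?thesis using c4 c6 c7 h1 h7
                  by - (rule region_step_swap[where m=11 and n=4]; simp add: region_def)
              next
                case c7: False
                show ?thesis using c4 c7 h1 h7
                  by - (rule region_step_two[where m=7 and n=9]; simp add: region_def)
              qed
            qed
          next
            case c5: False
            show ?thesis
            proof (cases "225 * g \<le> 25 * b + 299 * h")
              case c6: True
              show ?thesis
              proof (cases "7450 * b + 29950 * g \<le> 2500 * k + 89251 * h")
                case c7: True
                show ?thesis using c2 c4 c6 c7 h0 h1
                  by - (rule region_step_swap[where m=12 and n=3]; simp add: region_def)
              next
                case c7: False
                show ?thesis using c5 c6 c7 h1 h7
                  by - (rule region_step_two[where m=7 and n=7]; simp add: region_def)
              qed
            next
              case c6: False
              show ?thesis
              proof (cases "2500 * k + 78011 * h \<le> 9050 * b + 21550 * g")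
                case c7: True
                show ?thesis using c2 c5 c6 c7 h1 h7
                  by - (rule region_step_swap[where m=9 and n=4]; simp add: region_def)
              next
                case c7: False
                show ?thesis using c2 c7 h1 h7
                  by - (rule region_step_swap[where m=8 and n=4]; simp add: region_def)
              qed
            qed
          qed
        qed
      next
        case c3: False
        show ?thesis
        proof (cases "14950 * b + 22450 * g \<le> 2500 * k + 134251 * h")
          case c4: True
          show ?thesis
          proof (cases "250 * g + 2043 * h \<le> 400 * b")
            case c5: True
            show ?thesis
            proof (cases "2500 * k + 121111 * h \<le> 14050 * b + 21550 * g")
              case c6: True
              show ?thesis using c4 c5 c6 h0 h6 h7
                by - (rule region_step_two[where m=9 and n=6]; simp add: region_def)
            next
              case c6: False
              show ?thesis
              proof (cases "19950 * b + 19950 * g \<le> 2500 * k + 159201 * h")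
                case c7: True
                show ?thesis
                proof (cases "225 * b \<le> 25 * g + 1524 * h")
                  case c8: True
                  show ?thesis using c3 c6 c7 c8 h0 h6
                    by - (rule region_step_two[where m=8 and n=8]; simp add: region_def)
                next
                  case c8: False
                  show ?thesis using c2 c7 c8 h0
                    by - (rule region_step_two[where m=9 and n=5]; simp add: region_def)
                qed
              next
                case c7: False
                show ?thesis using c6 c7 h0 h6 h8
                  by - (rule region_step_two[where m=9 and n=5]; simp add: region_def)
              qed
            qed
          next
            case c5: False
            show ?thesis
            proof (cases "19950 * b + 19950 * g \<le> 2500 * k + 159201 * h")
              case c6: True
              show ?thesis using c3 c5 c6 h0 h7 h8
                by - (rule region_step_two[where m=8 and n=8]; simp add: region_def)
            next
              case c6: False
              show ?thesis using c4 c5 c6 h7 h8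
                by - (rule region_step_two[where m=8 and n=9]; simp add: region_def)
            qed
          qed
        next
          case c4: False
          show ?thesis
          proof (cases "17450 * b + 22450 * g \<le> 2500 * k + 156701 * h")
            case c5: True
            show ?thesis
            proof (cases "2500 * k + 142661 * h \<le> 16550 * b + 21550 * g")
              case c6: True
              show ?thesis using c4 c5 c6 h0 h6 h7 h8
                by - (rule region_step_two[where m=9 and n=7]; simp add: region_def)
            next
              case c6: False
              show ?thesis using c4 c6 h7 h8
                by - (rule region_step_two[where m=8 and n=9]; simp add: region_def)
            qed
          next
            case c5: False
            show ?thesis
            proof (cases "1250 * k + 76287 * h \<le> 8275 * b + 11350 * g")
              case c6: True
              show ?thesis
              proof (cases "22450 * b + 22450 * g \<le> 2500 * k + 201601 * h")
                case c7: True
                show ?thesis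
                proof (cases "225 * b \<le> 25 * g + 1724 * h")
                  case c8: True
                  show ?thesis
                  proof (cases "2500 * k + 185761 * h \<le> 21550 * b + 21550 * g")
                    case c9: True
                    show ?thesis using c6 c7 c8 c9 h7 h8
                      by - (rule region_step_two[where m=9 and n=9]; simp add: region_def)
                  next
                    case c9: False
                    show ?thesis using c6 c9 h0 h7 h8
                      by - (rule region_step_two[where m=9 and n=8]; simp add: region_def)
                  qed
                next
                  case c8: False
                  show ?thesis
                  proof (cases "2500 * k + 135161 * h \<le> 14050 * b + 24050 * g")
                    case c9: True
                    show ?thesis using c7 c8 c9 h0 h6 h8
                      by - (rule region_step_two[where m=10 and n=6]; simp add: region_def)
                  next
                    case c9: False
                    show ?thesis using c6 c8 c9 h0 h6 h8
                      by - (rule region_step_two[where m=10 and n=5]; simp add: region_def)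
                  qed
                qed
              next
                case c7: False
                show ?thesis
                proof (cases "2500 * k + 159211 * h \<le> 16550 * b + 24050 * g")
                  case c8: True
                  show ?thesis
                  proof (cases "17450 * b + 24950 * g \<le> 2500 * k + 174151 * h")
                    case c9: True
                    show ?thesis using c7 c8 c9 h0 h6 h7 h8
                      by - (rule region_step_two[where m=10 and n=7]; simp add: region_def)
                  next
                    case c9: False
                    show ?thesis using c9 h0 h7 h8
                      by - (rule region_step_two[where m=9 and n=11]; simp add: region_def)
                  qed
                next
                  case c8: False
                  show ?thesis
                  proof (cases "2500 * k + 135161 * h \<le> 14050 * b + 24050 * g")
                    case c9: True
                    show ?thesis using c7 c8 c9 h0 h6 h8
                      by - (rule region_step_two[where m=10 and n=6]; simp add: region_def)
                  next
                    case c9: False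
                    show ?thesis using c7 c9 h0 h6
                      by - (rule region_step_two[where m=10 and n=5]; simp add: region_def)
                  qed
                qed
              qed
            next
              case c6: False
              show ?thesis
              proof (cases "225 * b \<le> 25 * g + 1749 * h")
                case c7: True
                show ?thesis using c5 c6 c7 h0 h7 h8
                  by - (rule region_step_two[where m=9 and n=8]; simp add: region_def)
              next
                case c7: False
                show ?thesis using c6 c7 h0 h6
                  by - (rule region_step_two[where m=10 and n=5]; simp add: region_def)
              qed
            qed
          qed
        qed
      qed
    qed
  next
    case c1: False
    show ?thesis
    proof (cases "201 * g \<le> 25 * k + 225 * h")
      case c2: True
      show ?thesis
      proof (cases "2500 * b + 249 * g \<le> 50 * k + 12450 * h")
        case c3: True
        show ?thesis
        proof (cases "1412 * g + 3275 * h \<le> 100 * k + 1250 * b")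
          case c4: True
          show ?thesis using c0 c2 c3 c4 h0 h1 h6
            by - (rule region_step_one[where m=5]; simp add: region_def)
        next
          case c4: False
          show ?thesis
          proof (cases "12450 * b + 12450 * g \<le> 2500 * k + 62001 * h")
            case c5: True
            show ?thesis using c0 c2 c4 c5 h1 h7
              by - (rule region_step_two[where m=5 and n=5]; simp add: region_def)
          next
            case c5: False
            show ?thesis using c2 c4 c5 h1
              by - (rule region_step_two[where m=5 and n=6]; simp add: region_def)
          qed
        qed
      next
        case c3: False
        show ?thesis
        proof (cases "226 * g \<le> 25 * k + 225 * h")
          case c4: True
          show ?thesis
          proof (cases "1512 * g + 4525 * h \<le> 100 * k + 1250 * b")
            case c5: True
            show ?thesis
            proof (cases "2500 * b + 299 * g \<le> 50 * k + 14950 * h")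
              case c6: True
              show ?thesis using c3 c4 c5 c6 h0 h6
                by - (rule region_step_one[where m=6]; simp add: region_def)
            next
              case c6: False
              show ?thesis using c1 c6 h0 h6
                by - (rule region_step_one[where m=7]; simp add: region_def)
            qed
          next
            case c5: False
            show ?thesis using c3 c4 c5 h0
              by - (rule region_step_two[where m=6 and n=6]; simp add: region_def)
          qed
        next
          case c4: False
          show ?thesis
          proof (cases "250 * b \<le> 400 * g + 857 * h")
            case c5: True
            show ?thesis using c1 c3 c4 c5 h0 h6
              by - (rule region_step_swap[where m=8 and n=3]; simp add: region_def)
          next
            case c5: False
            show ?thesis
            proof (cases "2500 * k + 76461 * h \<le> 11550 * b + 16550 * g")
              case c6: True
              show ?thesis using c1 c4 c5 c6 h0 h6
                by - (rule region_step_two[where m=7 and n=5]; simp add: region_def)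
            next
              case c6: False
              show ?thesis using c4 c5 c6 h6
                by - (rule region_step_two[where m=7 and n=4]; simp add: region_def)
            qed
          qed
        qed
      qed
    next
      case c2: False
      show ?thesis
      proof (cases "2500 * k + 49911 * h \<le> 6550 * b + 19050 * g")
        case c3: True
        show ?thesis using c1 c2 c3 h0 h1 h7
          by - (rule region_step_swap[where m=8 and n=3]; simp add: region_def)
      next
        case c3: False
        show ?thesis
        proof (cases "250 * b \<le> 400 * g + 607 * h")
          case c4: True
          show ?thesis
          proof (cases "2500 * k + 43361 * h \<le> 6550 * b + 16550 * g")
            case c5: True
            show ?thesis using c0 c2 c3 c4 c5 h1 h7
              by - (rule region_step_swap[where m=7 and n=3]; simp add: region_def)
          next
            case c5: False
            show ?thesis using c0 c2 c5 h7
              by - (rule region_step_two[where m=5 and n=5]; simp add: region_def)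
          qed
        next
          case c4: False
          show ?thesis using c2 c3 c4 h1
            by - (rule region_step_two[where m=6 and n=5]; simp add: region_def)
        qed
      qed
    qed
  qed
qed

lemma region_step_range1:
  assumes h0: "57 * k + 50 * b \<le> 200 * g"
    and h1: "800 * g \<le> 133 * k + 450 * b"
    and h2: "912 * k + 100 * b + 1250 * h \<le> 2975 * g"
    and h3: "400 * g \<le> 57 * k + 250 * b"
    and h4: "50 * b + 50 * g \<le> k + 2500 * h"
    and h5: "361 * k + 2500 * h \<le> 950 * b + 950 * g"
    and h6: "0 \<le> k"
    and h7: "383 * k \<le> 175 * b + 175 * g"
    and h8: "1350 * b + 3600 * g \<le> 981 * k + 12500 * h"
  shows "region_step k b g h"
\<comment> \<open>Again f(1/50, 1/50) <= 0, now for the single digit 3.\<close>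
proof (cases "2500 * b + 149 * g \<le> 50 * k + 7450 * h")
  case c0: True
  show ?thesis
  proof (cases "151 * g \<le> 25 * k + 225 * h")
    case c1: True
    show ?thesis using c0 c1 h0 h1 h5 h6 h7
      by - (rule region_step_one[where m=3]; simp add: region_def)
  next
    case c1: False
    show ?thesis
    proof (cases "7450 * b + 14950 * g \<le> 2500 * k + 44551 * h")
      case c2: True
      show ?thesis using c0 c1 c2 h1 h6 h7
        by - (rule region_step_swap[where m=6 and n=3]; simp add: region_def)
    next
      case c2: False
      show ?thesis using c0 c2 h1 h6 h7
        by - (rule region_step_two[where m=4 and n=6]; simp add: region_def)
    qed
  qed
next
  case c0: False
  show ?thesis
  proof (cases "7450 * b + 19950 * g \<le> 2500 * k + 59451 * h")
    case c1: True
    show ?thesis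
    proof (cases "2500 * k + 43361 * h \<le> 6550 * b + 16550 * g")
      case c2: True
      show ?thesis
      proof (cases "7450 * b + 17450 * g \<le> 2500 * k + 52001 * h")
        case c3: True
        show ?thesis
        proof (cases "250 * b \<le> 400 * g + 607 * h")
          case c4: True
          show ?thesis
          proof (cases "1250 * k + 18937 * h \<le> 3850 * b + 5775 * g")
            case c5: True
            show ?thesis using c2 c3 c4 c5 h0 h1 h7
              by - (rule region_step_swap[where m=7 and n=3]; simp add: region_def)
          next
            case c5: False
            show ?thesis using c0 c2 c5 h7
              by - (rule region_step_two[where m=4 and n=5]; simp add: region_def)
          qed
        next
          case c4: False
          show ?thesis
          proof (cases "9950 * b + 14950 * g \<le> 2500 * k + 59501 * h")
            case c5: True
            show ?thesis using c2 c4 c5 h0 h6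
              by - (rule region_step_two[where m=6 and n=4]; simp add: region_def)
          next
            case c5: False
            show ?thesis using c3 c4 c5 h0 h6
              by - (rule region_step_two[where m=6 and n=5]; simp add: region_def)
          qed
        qed
      next
        case c3: False
        show ?thesis
        proof (cases "225 * g \<le> 25 * b + 399 * h")
          case c4: True
          show ?thesis
          proof (cases "2500 * k + 49911 * h \<le> 6550 * b + 19050 * g")
            case c5: True
            show ?thesis using c1 c3 c4 c5 h0 h6 h7
              by - (rule region_step_swap[where m=8 and n=3]; simp add: region_def)
          next
            case c5: False
            show ?thesis using c3 c5 h0 h6
              by - (rule region_step_two[where m=6 and n=5]; simp add: region_def)
          qed
        next
          case c4: False
          show ?thesis using c1 c4 h1 h7
            by - (rule region_step_two[where m=4 and n=7]; simp add: region_def)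
        qed
      qed
    next
      case c2: False
      show ?thesis
      proof (cases "176 * g \<le> 25 * k + 225 * h")
        case c3: True
        show ?thesis
        proof (cases "1312 * g + 2025 * h \<le> 100 * k + 1250 * b")
          case c4: True
          show ?thesis
          proof (cases "2500 * b + 199 * g \<le> 50 * k + 9950 * h")
            case c5: True
            show ?thesis using c0 c3 c4 c5 h0 h6 h7
              by - (rule region_step_one[where m=4]; simp add: region_def)
          next
            case c5: False
            show ?thesis
            proof (cases "1412 * g + 3275 * h \<le> 100 * k + 1250 * b")
              case c6: True
              show ?thesis using c2 c5 c6 h0 h6
                by - (rule region_step_one[where m=5]; simp add: region_def)
            next
              case c6: False
              show ?thesis using c2 c5 c6 h0
                by - (rule region_step_two[where m=5 and n=5]; simp add: region_def)
            qed
          qed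
        next
          case c4: False
          show ?thesis
          proof (cases "1250 * k + 14512 * h \<le> 3275 * b + 5100 * g")
            case c5: True
            show ?thesis
            proof (cases "12450 * b + 9950 * g \<le> 2500 * k + 49551 * h")
              case c6: True
              show ?thesis using c0 c3 c4 c5 c6 h6 h7
                by - (rule region_step_two[where m=4 and n=5]; simp add: region_def)
            next
              case c6: False
              show ?thesis using c3 c4 c6 h6
                by - (rule region_step_two[where m=4 and n=6]; simp add: region_def)
            qed
          next
            case c5: False
            show ?thesis using c0 c4 c5 h7
              by - (rule region_step_two[where m=4 and n=4]; simp add: region_def)
          qed
        qed
      next
        case c3: False
        show ?thesis
        proof (cases "2500 * k + 36811 * h \<le> 6550 * b + 14050 * g")
          case c4: True
          show ?thesis using c0 c2 c3 c4 h6 h7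
            by - (rule region_step_swap[where m=6 and n=3]; simp add: region_def)
        next
          case c4: False
          show ?thesis using c0 c3 c4 h7
            by - (rule region_step_two[where m=4 and n=5]; simp add: region_def)
        qed
      qed
    qed
  next
    case c1: False
    show ?thesis
    proof (cases "2500 * k + 68961 * h \<le> 9050 * b + 19050 * g")
      case c2: True
      show ?thesis
      proof (cases "2500 * k + 78011 * h \<le> 9050 * b + 21550 * g")
        case c3: True
        show ?thesis
        proof (cases "9950 * b + 22450 * g \<le> 2500 * k + 89351 * h")
          case c4: True
          show ?thesis
          proof (cases "250 * b \<le> 400 * g + 707 * h")
            case c5: True
            show ?thesis using c3 c4 c5 h0 h1 h7 h8
              by - (rule region_step_swap[where m=9 and n=4]; simp add: region_def)
          next
            case c5: False
            show ?thesis
            proof (cases "17450 * b + 17450 * g \<le> 2500 * k + 121801 * h")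
              case c6: True
              show ?thesis
              proof (cases "2500 * k + 109561 * h \<le> 16550 * b + 16550 * g")
                case c7: True
                show ?thesis using c5 c6 c7 h0 h6 h8
                  by - (rule region_step_two[where m=7 and n=7]; simp add: region_def)
              next
                case c7: False
                show ?thesis using c3 c5 c7 h6
                  by - (rule region_step_two[where m=7 and n=6]; simp add: region_def)
              qed
            next
              case c6: False
              show ?thesis using c4 c6 h0 h8
                by - (rule region_step_two[where m=7 and n=8]; simp add: region_def)
            qed
          qed
        next
          case c4: False
          show ?thesis
          proof (cases "9950 * b + 24950 * g \<le> 2500 * k + 99301 * h")
            case c5: True
            show ?thesis
            proof (cases "2500 * k + 87061 * h \<le> 9050 * b + 24050 * g")
              case c6: True
              show ?thesis using c4 c5 c6 h0 h1 h7 h8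
                by - (rule region_step_swap[where m=10 and n=4]; simp add: region_def)
            next
              case c6: False
              show ?thesis using c4 c6 h0 h8
                by - (rule region_step_two[where m=7 and n=8]; simp add: region_def)
            qed
          next
            case c5: False
            show ?thesis
            proof (cases "9950 * b + 27450 * g \<le> 2500 * k + 109251 * h")
              case c6: True
              show ?thesis using c5 c6 h0 h1 h7 h8
                by - (rule region_step_swap[where m=11 and n=4]; simp add: region_def)
            next
              case c6: False
              show ?thesis
              proof (cases "225 * g \<le> 25 * b + 524 * h")
                case c7: True
                show ?thesis using c6 c7 h0 h7 h8
                  by - (rule region_step_swap[where m=12 and n=4]; simp add: region_def)
              next
                case c7: False
                show ?thesis using c7 h1 h7 h8
                  by - (rule region_step_two[where m=6 and n=8]; simp add: region_def)
              qed
            qed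
          qed
        qed
      next
        case c3: False
        show ?thesis
        proof (cases "250 * b \<le> 400 * g + 457 * h")
          case c4: True
          show ?thesis using c2 c3 c4 h0 h1 h6 h7
            by - (rule region_step_swap[where m=8 and n=4]; simp add: region_def)
        next
          case c4: False
          show ?thesis
          proof (cases "7450 * b + 24950 * g \<le> 2500 * k + 74351 * h")
            case c5: True
            show ?thesis
            proof (cases "2500 * k + 63011 * h \<le> 6550 * b + 24050 * g")
              case c6: True
              show ?thesis using c2 c3 c4 c5 c6 h0 h6
                by - (rule region_step_swap[where m=10 and n=3]; simp add: region_def)
            next
              case c6: False
              show ?thesis using c2 c6 h0 h6
                by - (rule region_step_two[where m=7 and n=5]; simp add: region_def)
            qed
          next
            case c5: False
            show ?thesis using c3 c4 c5 h0 h6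
              by - (rule region_step_swap[where m=11 and n=3]; simp add: region_def)
          qed
        qed
      qed
    next
      case c2: False
      show ?thesis
      proof (cases "7450 * b + 22450 * g \<le> 2500 * k + 66901 * h")
        case c3: True
        show ?thesis
        proof (cases "225 * g \<le> 25 * b + 374 * h")
          case c4: True
          show ?thesis using c1 c2 c3 c4 h0 h1 h6
            by - (rule region_step_swap[where m=9 and n=3]; simp add: region_def)
        next
          case c4: False
          show ?thesis
          proof (cases "12450 * b + 12450 * g \<le> 2500 * k + 62001 * h")
            case c5: True
            show ?thesis using c1 c5 h1 h7
              by - (rule region_step_two[where m=5 and n=5]; simp add: region_def)
          next
            case c5: False
            show ?thesis using c3 c4 c5 h1 h7
              by - (rule region_step_two[where m=5 and n=6]; simp add: region_def)
          qed
        qed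
      next
        case c3: False
        show ?thesis
        proof (cases "250 * b \<le> 400 * g + 207 * h")
          case c4: True
          show ?thesis
          proof (cases "2500 * k + 59911 * h \<le> 9050 * b + 16550 * g")
            case c5: True
            show ?thesis using c2 c3 c4 c5 h1 h6 h7
              by - (rule region_step_swap[where m=7 and n=4]; simp add: region_def)
          next
            case c5: False
            show ?thesis
            proof (cases "2500 * k + 64911 * h \<le> 14050 * b + 11550 * g")
              case c6: True
              show ?thesis using c3 c5 c6 h1 h7
                by - (rule region_step_two[where m=5 and n=6]; simp add: region_def)
            next
              case c6: False
              show ?thesis using c3 c5 c6 h1 h7
                by - (rule region_step_two[where m=5 and n=5]; simp add: region_def)
            qed
          qed
        next
          case c4: False
          show ?thesis
          proof (cases "225 * g \<le> 25 * b + 349 * h")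
            case c5: True
            show ?thesis using c2 c3 c4 c5 h0 h6
              by - (rule region_step_swap[where m=10 and n=3]; simp add: region_def)
          next
            case c5: False
            show ?thesis
            proof (cases "12450 * b + 14950 * g \<le> 2500 * k + 74451 * h")
              case c6: True
              show ?thesis using c4 c5 c6 h7
                by - (rule region_step_two[where m=6 and n=5]; simp add: region_def)
            next
              case c6: False
              show ?thesis using c2 c4 c5 c6 h7
                by - (rule region_step_two[where m=6 and n=6]; simp add: region_def)
            qed
          qed
        qed
      qed
    qed
  qed
qed

lemma region_step_range2:
  assumes h0: "133 * k + 450 * b \<le> 800 * g"
    and h1: "g \<le> b"
    and h2: "912 * k + 100 * b + 1250 * h \<le> 2975 * g"
    and h3: "400 * g \<le> 57 * k + 250 * b"
    and h4: "50 * b + 50 * g \<le> k + 2500 * h"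
    and h5: "361 * k + 2500 * h \<le> 950 * b + 950 * g"
    and h6: "0 \<le> k"
    and h7: "383 * k \<le> 175 * b + 175 * g"
    and h8: "1350 * b + 1800 * g \<le> 567 * k + 8750 * h"
  shows "region_step k b g h"
\<comment> \<open>The facet p <= 9 q for the curve obtained by splitting off the single digit
  3.\<close>
proof (cases "151 * g \<le> 25 * k + 225 * h")
  case c0: True
  show ?thesis using c0 h0 h3 h5 h6 h7
    by - (rule region_step_one[where m=3]; simp add: region_def)
next
  case c0: False
  show ?thesis
  proof (cases "17450 * b + 9950 * g \<le> 2500 * k + 69451 * h")
    case c1: True
    show ?thesis
    proof (cases "1250 * k + 18937 * h \<le> 3850 * b + 5775 * g")
      case c2: True
      show ?thesis
      proof (cases "14950 * b + 9950 * g \<le> 2500 * k + 59501 * h")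
        case c3: True
        show ?thesis
        proof (cases "1250 * k + 19612 * h \<le> 4525 * b + 5100 * g")
          case c4: True
          show ?thesis
          proof (cases "2500 * k + 50861 * h \<le> 14050 * b + 9050 * g")
            case c5: True
            show ?thesis using c3 c4 c5 h0 h3 h6
              by - (rule region_step_two[where m=4 and n=6]; simp add: region_def)
          next
            case c5: False
            show ?thesis using c2 c5 h0 h3 h6
              by - (rule region_step_two[where m=4 and n=5]; simp add: region_def)
          qed
        next
          case c4: False
          show ?thesis using c2 c4 h0 h3 h6
            by - (rule region_step_two[where m=4 and n=5]; simp add: region_def)
        qed
      next
        case c3: False
        show ?thesis using c1 c3 h0 h3 h6 h7
          by - (rule region_step_two[where m=4 and n=7]; simp add: region_def)
      qed
    next
      case c2: False
      show ?thesis
      proof (cases "2500 * k + 36811 * h \<le> 6550 * b + 14050 * g")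
        case c3: True
        show ?thesis using c0 c2 c3 h0 h3 h6 h7
          by - (rule region_step_swap[where m=6 and n=3]; simp add: region_def)
      next
        case c3: False
        show ?thesis using c0 c3 h3 h6 h7
          by - (rule region_step_swap[where m=5 and n=3]; simp add: region_def)
      qed
    qed
  next
    case c1: False
    show ?thesis
    proof (cases "9950 * b + 17450 * g \<le> 2500 * k + 69451 * h")
      case c2: True
      show ?thesis
      proof (cases "2500 * k + 59911 * h \<le> 9050 * b + 16550 * g")
        case c3: True
        show ?thesis using c2 c3 h0 h3 h6 h7
          by - (rule region_step_swap[where m=7 and n=4]; simp add: region_def)
      next
        case c3: False
        show ?thesis
        proof (cases "250 * g + 693 * h \<le> 400 * b")
          case c4: True
          show ?thesis
          proof (cases "12450 * b + 12450 * g \<le> 2500 * k + 62001 * h")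
            case c5: True
            show ?thesis using c1 c3 c4 c5 h0 h3 h6 h7
              by - (rule region_step_two[where m=5 and n=5]; simp add: region_def)
          next
            case c5: False
            show ?thesis using c3 c5 h0 h3 h6
              by - (rule region_step_two[where m=5 and n=6]; simp add: region_def)
          qed
        next
          case c4: False
          show ?thesis using c1 c3 c4 h3 h7
            by - (rule region_step_swap[where m=6 and n=4]; simp add: region_def)
        qed
      qed
    next
      case c2: False
      show ?thesis
      proof (cases "2500 * k + 78011 * h \<le> 9050 * b + 21550 * g")
        case c3: True
        show ?thesis
        proof (cases "9950 * b + 22450 * g \<le> 2500 * k + 89351 * h")
          case c4: True
          show ?thesis
          proof (cases "1250 * k + 34912 * h \<le> 5100 * b + 8275 * g")
            case c5: True
            show ?thesis using c3 c4 c5 h0 h3 h7 h8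
              by - (rule region_step_swap[where m=9 and n=4]; simp add: region_def)
          next
            case c5: False
            show ?thesis using c3 c5 h3 h7
              by - (rule region_step_two[where m=5 and n=7]; simp add: region_def)
          qed
        next
          case c4: False
          show ?thesis
          proof (cases "9950 * b + 24950 * g \<le> 2500 * k + 99301 * h")
            case c5: True
            show ?thesis using c4 c5 h0 h3 h7 h8
              by - (rule region_step_swap[where m=10 and n=4]; simp add: region_def)
          next
            case c5: False
            show ?thesis using c5 h0 h3 h7 h8
              by - (rule region_step_swap[where m=8 and n=5]; simp add: region_def)
          qed
        qed
      next
        case c3: False
        show ?thesis using c2 c3 h0 h3 h6 h7
          by - (rule region_step_swap[where m=8 and n=4]; simp add: region_def)
      qed
    qed
  qed
qed

text \<open>
  The assumption \<open>large\<close> is \<open>h > 9/25 sqrt (b g - k h)\<close>. It becomes linear by bounding \<open>sqrt (p q)\<close>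
  from below by one of its chords \<open>L\<close>.
\<close>

lemma large_imp_linear_bound:
  fixes k b g h L :: real
  defines "p \<equiv> b - 19/50 * k" and "q \<equiv> g - 19/50 * k"
  assumes k: "0 \<le> k" and h: "0 \<le> h" and large: "81 * (b * g - k * h) < 625 * h\<^sup>2"
    and pq: "0 \<le> p" "0 \<le> q" and L: "0 \<le> L" "L\<^sup>2 \<le> p * q"
  shows "9/25 * L + 9/125 * k \<le> h"
proof (rule ccontr)
  assume "\<not> 9/25 * L + 9/125 * k \<le> h"
  \<comment> \<open>The shift 81/1250 completes the square in h^2 + 81/625 k h, and 9/125 + 81/1250
    = 9/25 * 19/50.\<close>
  then have "h + 81/1250 * k \<le> 9/25 * (L + 19/50 * k)" by simp
  then have "(h + 81/1250 * k)\<^sup>2 \<le> (9/25 * (L + 19/50 * k))\<^sup>2" using h k by (intro power_mono) auto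
  moreover have "(9/25 * y)\<^sup>2 = 81/625 * y\<^sup>2" for y :: real by (simp add: power2_eq_square)
  ultimately have "(h + 81/1250 * k)\<^sup>2 \<le> 81/625 * (L + 19/50 * k)\<^sup>2" by metis
  \<comment> \<open>By the arithmetic-geometric mean inequality 2 L <= p + q, so adding 19/50 k to
    both \<open>p\<close> and \<open>q\<close> raises their product at least as much as it raises
    L^2.\<close>
  moreover have "(L + 19/50 * k)\<^sup>2 \<le> b * g"
  proof -
    have "4 * (p * q) \<le> (p + q)\<^sup>2" using zero_le_power2[of "p - q"] by (simp add: power2_eq_square algebra_simps)
    then have "(2 * L)\<^sup>2 \<le> (p + q)\<^sup>2" using L by (simp add: power_mult_distrib)
    then have "2 * L \<le> p + q" by (rule power2_le_imp_le) (use pq in simp)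
    then have "19/50 * k * (2 * L) \<le> 19/50 * k * (p + q)" using k by (intro mult_left_mono) auto
    moreover have "b * g = p * q + 19/50 * k * (p + q) + (19/50 * k)\<^sup>2"
      by (simp add: p_def q_def power2_eq_square algebra_simps)
    ultimately show ?thesis using L by (simp add: power2_sum)
  qed
  moreover have "(h + 81/1250 * k)\<^sup>2 = h\<^sup>2 + 81/625 * (k * h) + (81/1250 * k)\<^sup>2"
    by (simp add: power2_eq_square algebra_simps)
  moreover have "0 \<le> (81/1250 * k)\<^sup>2" by simp
  ultimately have "625 * h\<^sup>2 + 81 * (k * h) \<le> 81 * (b * g)" by linarith
  then show False using large by (simp add: right_diff_distrib)
qed

lemma region_step_large:
  assumes region: "region k b g h" and large: "81 * (b * g - k * h) < 625 * h\<^sup>2"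
  shows "region_step k b g h"
proof -
  define p q where "p = b - 19/50 * k" and "q = g - 19/50 * k"
  have rows: "0 \<le> k" "383 * k \<le> 175 * b + 175 * g" "76 * k + 25 * b \<le> 225 * g"
    "400 * g \<le> 57 * k + 250 * b" "912 * k + 100 * b + 1250 * h \<le> 2975 * g"
    "50 * b + 50 * g \<le> k + 2500 * h" "361 * k + 2500 * h \<le> 950 * b + 950 * g"
    using region by (simp_all add: region_def)
  then have pq: "p \<le> 9 * q" "8 * q \<le> 5 * p" unfolding p_def q_def by simp_all
  then have pq0: "0 \<le> p" "0 \<le> q" by simp_all
  have h: "0 \<le> h" using rows pq0 unfolding p_def q_def by argo
  have bound: "9/25 * L + 9/125 * k \<le> h" if "0 \<le> L" "L\<^sup>2 \<le> p * q" for L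
    using large_imp_linear_bound[OF rows(1) h large, folded p_def q_def, OF pq0 that] .
  consider "4 * q \<le> p" | "p \<le> 4 * q" "16 * q \<le> 9 * p" | "9 * p \<le> 16 * q" by linarith
  then show ?thesis
  proof cases
    case 1
    \<comment> \<open>The chord of sqrt (p q) between the slopes q/p = 1/9 and 1/4. All breakpoints
      are squares of rationals, so the chords have rational coefficients.\<close>
    have "(9 * q - p) * (4 * q - p) \<le> 0" using pq 1 by (simp add: mult_le_0_iff)
    then have "((p + 6 * q) / 5)\<^sup>2 \<le> p * q" by (simp add: power2_eq_square algebra_simps)
    from bound[OF _ this] have "9/25 * ((p + 6 * q) / 5) + 9/125 * k \<le> h" using pq0 by simp
    then show ?thesis using rows 1 unfolding p_def q_def by - (rule region_step_range0; argo)
  next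
    case 2
    have "(4 * q - p) * (16 * q - 9 * p) \<le> 0" using 2 by (simp add: mult_le_0_iff)
    then have "((3 * p + 8 * q) / 10)\<^sup>2 \<le> p * q" by (simp add: power2_eq_square algebra_simps)
    from bound[OF _ this] have "9/25 * ((3 * p + 8 * q) / 10) + 9/125 * k \<le> h" using pq0 by simp
    then show ?thesis using rows 2 unfolding p_def q_def by - (rule region_step_range1; argo)
  next
    case 3
    \<comment> \<open>The cone ends at slope 5/8, whose root is irrational; the chord is drawn to
      slope 1 instead.\<close>
    have "(16 * q - 9 * p) * (q - p) \<le> 0" using pq pq0 3 by (simp add: mult_le_0_iff)
    then have "((3 * p + 4 * q) / 7)\<^sup>2 \<le> p * q" by (simp add: power2_eq_square algebra_simps)
    from bound[OF _ this] have "9/25 * ((3 * p + 4 * q) / 7) + 9/125 * k \<le> h" using pq0 by simp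
    moreover have "g \<le> b" using pq pq0 by (simp add: p_def q_def)
    ultimately show ?thesis using rows 3 unfolding p_def q_def by - (rule region_step_range2; argo)
  qed
qed

text \<open>All rows are homogeneous, so the determinant \<open>b * g - k * h\<close> may be
  normalised to 1.\<close>

lemma region_scale:
  assumes "0 < r"
  shows "region (r * k) (r * b) (r * g) (r * h) \<longleftrightarrow> region k b g h"
proof -
  have *: "x * (r * k) + y * (r * b) + z * (r * g) + u * (r * h) \<le> 0
      \<longleftrightarrow> x * k + y * b + z * g + u * h \<le> 0" for x y z u
  proof -
    have "x * (r * k) + y * (r * b) + z * (r * g) + u * (r * h) = r * (x * k + y * b + z * g + u * h)"
      by (simp add: algebra_simps)
    then show ?thesis using assms by (simp add: mult_le_0_iff)
  qed
  show ?thesis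
    unfolding region_def
    using *[of "-1" 0 0 0] *[of 383 "-175" "-175" 0] *[of 76 25 "-225" 0] *[of "-57" "-250" 400 0]
      *[of 912 100 "-2975" 1250] *[of "-1" 50 50 "-2500"] *[of 361 "-950" "-950" 2500]
    by (auto simp: algebra_simps)
qed

section \<open>Small constant term\<close>

text \<open>
  Coefficients are scaled such that \<open>b g - k h = 1\<close> and \<open>w\<close> is the scaled \<open>h\<close>. Increasing a digit by 1 shifts
  \<open>X\<close> or \<open>Y\<close> by \<open>w\<close>, and both windows for \<open>X\<close> and \<open>Y\<close> have length \<open>w\<close>, so they can be reached.
\<close>

lemma unit_region:
  fixes w X Y :: real
  defines "Z \<equiv> X + 9/25 * w"
  assumes w: "0 < w" "w \<le> 9/25" and X: "17/25 - w \<le> X" "X \<le> 17/25"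
    and Y: "1 / Z - 9/25 * w \<le> Y" "Y \<le> 1 / Z + 16/25 * w"
  shows "region w (Y + 19/50 * w) (X + 19/50 * w) (((X + 19/50 * w) * (Y + 19/50 * w) - 1) / w)"
    and "21/20 \<le> Y" "Y \<le> 17/5" "8/25 \<le> X"
proof -
  have X_ge: "8/25 \<le> X" using w X by linarith
  have Z_ge: "8/25 \<le> Z" using X_ge w by (simp add: Z_def)
  have Z_le: "Z \<le> 81/100" using X w by (simp add: Z_def)
  have inv: "Z * (1 / Z) = 1" using Z_ge by simp
  have invZ: "1 / Z \<le> 25/8" "100/81 \<le> 1 / Z" using Z_ge Z_le by (simp_all add: divide_simps)
  show Yb: "21/20 \<le> Y" "Y \<le> 17/5" "8/25 \<le> X" using Y invZ w X_ge by linarith+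
  \<comment> \<open>For determinant 1 one has w f(x, x) = 1 - (b - w x)(g - w x). At x = 1/50 the
    factors are \<open>Y + 9/25 * w\<close> and \<open>Z\<close>, at x = 19/50 they are
    \<open>Y\<close> and \<open>X\<close>; so this bound and \<open>XY\<close> are the last two rows
    of the cone.\<close>
  have ZY1: "1 \<le> Z * (Y + 9/25 * w)"
  proof -
    have "Z * (1 / Z) \<le> Z * (Y + 9/25 * w)" using Y(1) Z_ge by (intro mult_left_mono) auto
    then show ?thesis using inv by simp
  qed
  have ZY2: "Z * Y \<le> 1 + 16/25 * w * Z"
  proof -
    have "Z * Y \<le> Z * (1 / Z + 16/25 * w)" using Y(2) Z_ge by (intro mult_left_mono) auto
    also have "\<dots> = 1 + 16/25 * w * Z" using inv by (simp add: algebra_simps)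
    finally show ?thesis .
  qed
  have XY: "X * Y \<le> 1"
  proof -
    have "X * Z \<le> 17/25 * (81/100)" using X Z_le Z_ge X_ge by (intro mult_mono) auto
    \<comment> \<open>The factor 9/16 turns the excess 16/25 into 9/25, the difference between
      \<open>Z\<close> and \<open>X\<close> in units of \<open>w\<close>.\<close>
    then have "w * (X * Z) \<le> w * (9/16)" using w by (intro mult_left_mono) auto
    moreover have "X * (Z * Y) \<le> X * (1 + 16/25 * w * Z)" using ZY2 X_ge by (intro mult_left_mono) auto
    ultimately have "Z * (X * Y) \<le> Z * 1" by (simp add: Z_def algebra_simps)
    then show ?thesis using Z_ge by simp
  qed
  \<comment> \<open>The row 23/100 p <= q + 1/2 f(c, c), multiplied by 2 w, with w f(c, c) = 1 - X
    Y.\<close>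
  have slant: "Y * (X + 23/50 * w) \<le> 1 + 2 * w * X"
  proof -
    have "(8/25) * (8/25) \<le> X * X" "w * w \<le> (9/25) * (9/25)"
      by (intro mult_mono; use X_ge w in simp)+
    moreover have "0 \<le> w * X" using X_ge w by simp
    ultimately have rest: "0 \<le> 34/25 * (X * X) + 122/625 * (w * X) - 1/10 - 1656/15625 * (w * w)"
      by linarith
    have "Z * (Y * (X + 23/50 * w)) \<le> (1 + 16/25 * w * Z) * (X + 23/50 * w)"
      using mult_right_mono[OF ZY2, of "X + 23/50 * w"] X_ge w by (simp add: algebra_simps)
    also have "\<dots> = Z * (1 + 2 * w * X) - w * (34/25 * (X * X) + 122/625 * (w * X) - 1/10 - 1656/15625 * (w * w))"
      unfolding Z_def by (simp add: field_simps)
    also have "\<dots> \<le> Z * (1 + 2 * w * X)" using rest w by simp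
    finally show ?thesis using Z_ge by simp
  qed
  have lower: "Y \<le> 9 * X"
  proof -
    have "(17/25 - w) * (17/25 - w) \<le> X * X" "w * (17/25 - w) \<le> w * X"
      by (intro mult_mono; use X X_ge w in simp)+
    moreover have "0 \<le> (9/25 - w) * (9/25 - w)" by simp
    ultimately have "1 + 16/25 * w * Z \<le> 9 * X * Z" using w by (simp add: Z_def algebra_simps)
    then have "Z * Y \<le> Z * (9 * X)" using ZY2 by (simp add: algebra_simps)
    then show ?thesis using Z_ge by simp
  qed
  have upper: "8 * X \<le> 5 * Y"
  proof -
    have "Z * (8 * X + 9/5 * w) \<le> 81/100 * (761/125)" using X X_ge w Z_ge Z_le by (intro mult_mono) auto
    then have "Z * (8 * X) \<le> 5 - 9/5 * w * Z" by (simp add: algebra_simps)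
    also have "\<dots> \<le> Z * (5 * Y)" using ZY1 by (simp add: algebra_simps)
    finally show ?thesis using Z_ge by simp
  qed
  define H where "H = ((X + 19/50 * w) * (Y + 19/50 * w) - 1) / w"
  have H: "w * H = (X + 19/50 * w) * (Y + 19/50 * w) - 1" using w by (simp add: H_def)
  have cancel: "w * x \<le> w * y \<Longrightarrow> x \<le> y" for x y using w by simp
  show "region w (Y + 19/50 * w) (X + 19/50 * w) (((X + 19/50 * w) * (Y + 19/50 * w) - 1) / w)"
    unfolding H_def[symmetric] region_def
  proof (intro conjI)
    show "912 * w + 100 * (Y + 19/50 * w) + 1250 * H \<le> 2975 * (X + 19/50 * w)"
      by (rule cancel) (use slant H in \<open>simp add: algebra_simps\<close>)
    show "50 * (Y + 19/50 * w + (X + 19/50 * w)) \<le> w + 2500 * H"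
      by (rule cancel) (use ZY1 H in \<open>simp add: algebra_simps Z_def\<close>)
    show "361 * w + 2500 * H \<le> 950 * (Y + 19/50 * w + (X + 19/50 * w))"
      by (rule cancel) (use XY H in \<open>simp add: algebra_simps\<close>)
  qed (use w Yb lower upper in auto)
qed

text \<open>After division by the root \<open>r\<close> of the determinant, \<open>m\<close> is the
  largest digit with \<open>X \<le> 17/25\<close> and then \<open>n\<close> the least one with
  \<open>Y\<close> above the lower end of its window, so \<open>unit_region\<close> applies.
  Membership of the old curve in the cone is not assumed, so initial curves are covered. The bounds
  on \<open>real m * h\<close> and \<open>real n * h\<close> serve to cap the digits inside the
  cone.\<close>

lemma small_region:
  assumes k: "0 \<le> k" and g: "0 < g" "g \<le> b" and h: "0 < h"
    and small: "625 * h\<^sup>2 \<le> 81 * (b * g - k * h)"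
  obtains m n :: nat where "3 \<le> m" "3 \<le> n"
    "real m * h \<le> 2 * b + g + h" "real n * h \<le> 2 * b + 3 * g + h"
    "region h (real n * h - g) (real m * h - b) (real m * (real n * h - g) - (real n * b - k))"
proof -
  define D where "D = b * g - k * h"
  have "0 < 625 * h\<^sup>2" using h by simp
  also have "\<dots> \<le> 81 * D" using small by (simp add: D_def)
  finally have D: "0 < D" by simp
  define r where "r = sqrt D"
  have r: "0 < r" "r\<^sup>2 = D" using D by (simp_all add: r_def)
  define w where "w = h / r"
  have rw: "r * w = h" using r by (simp add: w_def)
  have w0: "0 < w" using h r by (simp add: w_def)
  have "(25 * h)\<^sup>2 \<le> (9 * r)\<^sup>2" using small r by (simp add: power_mult_distrib D_def)
  then have hr: "25 * h \<le> 9 * r" by (rule power2_le_imp_le) (use r in simp)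
  then have w1: "w \<le> 9/25" using r by (simp add: w_def divide_simps)
  have Dbg: "D \<le> b * g" using k h by (simp add: D_def)
  have "4 * (b * g) \<le> (b + g)\<^sup>2" using sum_squares_ge_zero[of "b - g" 0] by (simp add: power2_eq_square algebra_simps)
  then have "(2 * r)\<^sup>2 \<le> (b + g)\<^sup>2" using Dbg r by (simp add: power_mult_distrib)
  then have r_le: "2 * r \<le> b + g" by (rule power2_le_imp_le) (use g in simp)
  have "b * g \<le> b\<^sup>2" using g by (simp add: power2_eq_square)
  then have "r\<^sup>2 \<le> b\<^sup>2" using Dbg r by linarith
  then have r_le_b: "r \<le> b" by (rule power2_le_imp_le) (use g in simp)
  define m' where "m' = \<lfloor>(b + r * (17/25) + 19/50 * h) / h\<rfloor>"
  define X where "X = (m' * h - b) / r - 19/50 * w"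
  have rX: "r * (X + 19/50 * w) = m' * h - b" using r by (simp add: X_def)
  have "m' \<le> (b + r * (17/25) + 19/50 * h) / h" "(b + r * (17/25) + 19/50 * h) / h < m' + 1"
    unfolding m'_def by linarith+
  then have "m' * h \<le> b + r * (17/25) + 19/50 * h" "b + r * (17/25) + 19/50 * h < (m' + 1) * h"
    using h by (simp_all add: pos_le_divide_eq pos_divide_less_eq)
  then have m_bounds: "r * X \<le> r * (17/25)" "r * (17/25 - w) \<le> r * X"
    using rX rw by (simp_all add: algebra_simps)
  then have X: "X \<le> 17/25" "17/25 - w \<le> X" using r by simp_all
  define Z where "Z = X + 9/25 * w"
  define n' where "n' = \<lceil>(g + r * (1 / Z - 9/25 * w) + 19/50 * h) / h\<rceil>"
  define Y where "Y = (n' * h - g) / r - 19/50 * w"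
  have rY: "r * (Y + 19/50 * w) = n' * h - g" using r by (simp add: Y_def)
  have "(g + r * (1 / Z - 9/25 * w) + 19/50 * h) / h \<le> n'" "n' - 1 < (g + r * (1 / Z - 9/25 * w) + 19/50 * h) / h"
    unfolding n'_def by linarith+
  then have "g + r * (1 / Z - 9/25 * w) + 19/50 * h \<le> n' * h" "(n' - 1) * h < g + r * (1 / Z - 9/25 * w) + 19/50 * h"
    using h by (simp_all add: pos_divide_le_eq pos_less_divide_eq)
  then have "r * (1 / Z - 9/25 * w) \<le> r * Y" "r * Y \<le> r * (1 / Z + 16/25 * w)"
    using rY rw by (simp_all add: algebra_simps)
  then have Y: "1 / Z - 9/25 * w \<le> Y" "Y \<le> 1 / Z + 16/25 * w" using r by simp_all
  note unit = unit_region[OF w0 w1 X(2,1), folded Z_def, OF Y]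
  have rX': "r * X = m' * h - b - 19/50 * h" and rY': "r * Y = n' * h - g - 19/50 * h"
    using rX rY rw by (simp_all add: algebra_simps)
  have X8: "r * (8/25) \<le> r * X" "r * (21/20) \<le> r * Y" "r * Y \<le> r * (17/5)"
    using unit(2-4) r by (auto intro!: mult_left_mono)
  have "3 * h < m' * h" using X8(1) rX' hr r_le_b h by linarith
  then have m3: "3 \<le> m'" using h by simp
  have "3 * h < n' * h" using X8(2) rY' hr g h by linarith
  then have n3: "3 \<le> n'" using h by simp
  have mh: "m' * h \<le> 2 * b + g + h" using m_bounds(1) rX' r_le g h by linarith
  have nh: "n' * h \<le> 2 * b + 3 * g + h" using X8(3) rY' r_le g h by linarith
  define Q where "Q = ((X + 19/50 * w) * (Y + 19/50 * w) - 1) / w"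
  have wQ: "w * Q = (X + 19/50 * w) * (Y + 19/50 * w) - 1" using w0 by (simp add: Q_def)
  \<comment> \<open>\<open>Q\<close> was defined by determinant 1; invariance of the determinant
    identifies \<open>r * Q\<close> with the constant term of the split curve.\<close>
  have "h * (r * Q) = r\<^sup>2 * (w * Q)" unfolding rw[symmetric] by (simp add: power2_eq_square)
  also have "\<dots> = (r * (X + 19/50 * w)) * (r * (Y + 19/50 * w)) - r\<^sup>2"
    unfolding wQ by (simp add: power2_eq_square right_diff_distrib)
  also have "\<dots> = h * (m' * (n' * h - g) - (n' * b - k))"
    unfolding rX rY r(2) D_def by (simp add: algebra_simps)
  finally have rQ: "r * Q = m' * (n' * h - g) - (n' * b - k)" using h by simp
  have "region h (n' * h - g) (m' * h - b) (m' * (n' * h - g) - (n' * b - k))"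
    using region_scale[OF r(1), THEN iffD2, OF unit(1)[folded Q_def]] unfolding rX rY rQ rw .
  with that[of "nat m'" "nat n'"] m3 n3 mh nh show ?thesis by simp
qed

section \<open>From the cone to zeros with digits of every depth\<close>

lemma region_imp_step:
  assumes region: "region k b g h"
  shows "region_step k b g h"
proof (cases "0 < b \<and> 625 * h\<^sup>2 \<le> 81 * (b * g - k * h)")
  case True
  have rows: "0 \<le> k" "383 * k \<le> 175 * b + 175 * g" "76 * k + 25 * b \<le> 225 * g"
    "400 * g \<le> 57 * k + 250 * b" "50 * b + 50 * g \<le> k + 2500 * h"
    using region by (simp_all add: region_def)
  moreover have "0 < b" using True by simp
  ultimately have g: "0 < g" "g \<le> b" and h: "0 < h" by linarith+
  obtain m n :: nat where mn: "3 \<le> m" "3 \<le> n"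
    "real m * h \<le> 2 * b + g + h" "real n * h \<le> 2 * b + 3 * g + h"
    and R: "region h (real n * h - g) (real m * h - b) (real m * (real n * h - g) - (real n * b - k))"
    using small_region[of k g b h] rows(1) g h True by metis
  \<comment> \<open>The row f(1/50, 1/50) <= 0 and the bound on \<open>k\<close> give b + g <= 51 h,
    which bounds the digits.\<close>
  have "real m * h \<le> 200 * h" "real n * h \<le> 200 * h" using mn(3,4) rows g by linarith+
  then have "m \<in> {3..200}" "n \<in> {3..200}" using mn h by simp_all
  then show ?thesis using R by (rule region_step_two)
next
  case False
  show ?thesis
  proof (cases "0 < b")
    case True
    then show ?thesis using region False by (intro region_step_large) auto
  next
    case False
    \<comment> \<open>The apex of the cone, which any digit maps to itself.\<close>
    then have "k = 0" "b = 0" "g = 0" "h = 0" using region unfolding region_def by linarith+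
    then show ?thesis by (intro region_step_one[where m=3]) (simp_all add: region_def)
  qed
qed

text \<open>A one-sided split deepens only the first coordinate and then exchanges the two. Hence
  the intermediate statement \<open>E n\<close>, with depth \<open>Suc n\<close> in the first
  coordinate only: \<open>D n\<close> gives \<open>E n\<close>, and \<open>E n\<close> for the
  exchanged curve supplies the missing digit of the second coordinate in
  \<open>D (Suc n)\<close>.\<close>

lemma region_solution_survivors:
  assumes "region k b g h"
  shows "\<exists>s\<in>survivors n. \<exists>t\<in>survivors n. curve k b g h s t = 0"
proof -
  define D where "D n \<longleftrightarrow> (\<forall>k b g h. region k b g h \<longrightarrow>
      (\<exists>s\<in>survivors n. \<exists>t\<in>survivors n. curve k b g h s t = 0))" for n
  define E where "E n \<longleftrightarrow> (\<forall>k b g h. region k b g h \<longrightarrow>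
      (\<exists>s\<in>survivors (Suc n). \<exists>t\<in>survivors n. curve k b g h s t = 0))" for n
  have ne: "real m \<noteq> s" if "s \<in> survivors n" "m \<in> {3..200}" for s m n
    using that survivors_bounds[of s n] inverse_diff_bounds(3)[of s m] by auto
  have both: "\<exists>s\<in>survivors (Suc n). \<exists>t\<in>survivors (Suc n). curve k b g h s t = 0"
    if "D n" and m: "m \<in> {3..200}" and m': "m' \<in> {3..200}"
      and R: "region h (real m' * h - g) (real m * h - b) (real m * (real m' * h - g) - (real m' * b - k))
        \<or> region h (real m * h - b) (real m' * h - g) (real m * (real m' * h - g) - (real m' * b - k))"
    for n m m' k b g h
  proof -
    let ?B = "real m' * h - g" and ?G = "real m * h - b"
      and ?H = "real m * (real m' * h - g) - (real m' * b - k)"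
    have "\<exists>s\<in>survivors n. \<exists>t\<in>survivors n. curve h ?B ?G ?H s t = 0"
      using R
    proof
      assume "region h ?B ?G ?H"
      with \<open>D n\<close> show ?thesis unfolding D_def by blast
    next
      assume "region h ?G ?B ?H"
      with \<open>D n\<close> have "\<exists>t\<in>survivors n. \<exists>s\<in>survivors n. curve h ?G ?B ?H t s = 0"
        unfolding D_def by blast
      then show ?thesis unfolding curve_swap[of h ?G ?B] by blast
    qed
    then obtain s t where st: "s \<in> survivors n" "t \<in> survivors n" "curve h ?B ?G ?H s t = 0" by blast
    then have "curve k b g h (1 / (real m - s)) (1 / (real m' - t)) = 0"
      using curve_split_both[OF ne[OF st(1) m] ne[OF st(2) m']] ne[OF st(1) m] ne[OF st(2) m'] by auto
    then show ?thesis using survivorsI[OF st(1) m] survivorsI[OF st(2) m'] by blast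
  qed
  have left: "\<exists>s\<in>survivors (Suc n). \<exists>t\<in>survivors l. curve k b g h s t = 0"
    if ex: "\<exists>t\<in>survivors l. \<exists>s\<in>survivors n. curve g (real m * g - k) h (real m * h - b) t s = 0"
      and m: "m \<in> {3..200}" for n l m k b g h
  proof -
    obtain s t where st: "s \<in> survivors n" "t \<in> survivors l"
      "curve g h (real m * g - k) (real m * h - b) s t = 0"
      using ex unfolding curve_swap[of g "real m * g - k" h] by blast
    then have "curve k b g h (1 / (real m - s)) t = 0"
      using curve_split_left[OF ne[OF st(1) m]] ne[OF st(1) m] by auto
    then show ?thesis using survivorsI[OF st(1) m] st(2) by blast
  qed
  have DE: "E n" if "D n" for n
    unfolding E_def
  proof (intro allI impI)
    fix k b g h assume "region k b g h"
    then consider m where "m \<in> {3..200}" "region g (real m * g - k) h (real m * h - b)"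
      | m m' where "m \<in> {3..200}" "m' \<in> {3..200}"
        "region h (real m' * h - g) (real m * h - b) (real m * (real m' * h - g) - (real m' * b - k))
        \<or> region h (real m * h - b) (real m' * h - g) (real m * (real m' * h - g) - (real m' * b - k))"
      using region_imp_step unfolding region_step_def Let_def by blast
    then show "\<exists>s\<in>survivors (Suc n). \<exists>t\<in>survivors n. curve k b g h s t = 0"
    proof cases
      case 1
      then show ?thesis using \<open>D n\<close> by (intro left) (auto simp: D_def)
    next
      case 2
      then show ?thesis using both[OF \<open>D n\<close> 2] survivors_Suc_subset by blast
    qed
  qed
  have ED: "D (Suc n)" if "D n" "E n" for n
    unfolding D_def
  proof (intro allI impI)
    fix k b g h assume "region k b g h"
    then consider m where "m \<in> {3..200}" "region g (real m * g - k) h (real m * h - b)"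
      | m m' where "m \<in> {3..200}" "m' \<in> {3..200}"
        "region h (real m' * h - g) (real m * h - b) (real m * (real m' * h - g) - (real m' * b - k))
        \<or> region h (real m * h - b) (real m' * h - g) (real m * (real m' * h - g) - (real m' * b - k))"
      using region_imp_step unfolding region_step_def Let_def by blast
    then show "\<exists>s\<in>survivors (Suc n). \<exists>t\<in>survivors (Suc n). curve k b g h s t = 0"
    proof cases
      case 1
      then show ?thesis using \<open>E n\<close> by (intro left) (auto simp only: E_def)
    next
      case 2
      then show ?thesis using both[OF \<open>D n\<close> 2] by blast
    qed
  qed
  have D0: "D 0"
    unfolding D_def
  proof (intro allI impI)
    fix k b g h assume R: "region k b g h"
    \<comment> \<open>The last two rows of the cone give the sign change on the diagonal.\<close>
    have "\<exists>p\<ge>1/50. p \<le> 19/50 \<and> curve k b g h p p = 0"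
      by (rule IVT') (use R in \<open>auto simp: region_def curve_def intro!: continuous_intros\<close>)
    then show "\<exists>s\<in>survivors 0. \<exists>t\<in>survivors 0. curve k b g h s t = 0" by force
  qed
  have "D n" for n by (induction n) (use D0 DE ED in auto)
  then show ?thesis using assms unfolding D_def by blast
qed

section \<open>Solutions\<close>

lemma minus_cf_bounds:
  assumes "minus_cf s"
  shows "0 \<le> s" "s \<le> 1/2"
  using assms by (cases; use inverse_diff_bounds in blast)+

lemma region_solution:
  assumes "region k b g h"
  shows "\<exists>s t. minus_cf s \<and> minus_cf t \<and> curve k b g h s t = 0"
  using region_solution_survivors[OF assms] by (rule survivors_solution)

lemma solution_split_left:
  assumes "minus_cf s" "3 \<le> m"
    "curve g h (real m * g - k) (real m * h - b) s t = 0"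
  shows "minus_cf (1 / (real m - s)) \<and> curve k b g h (1 / (real m - s)) t = 0"
proof -
  note s = minus_cf_bounds[OF assms(1)]
  have ne: "real m \<noteq> s" using s assms(2) by linarith
  then have "curve k b g h (1 / (real m - s)) t = 0"
    using curve_split_left[OF ne, of g h k b t] assms(3) by simp
  then show ?thesis using minus_cf.intros[OF assms(1) s assms(2)] by blast
qed

lemma solution_split_both:
  assumes "minus_cf s" "minus_cf t" "3 \<le> m" "3 \<le> n"
    "curve h (real n * h - g) (real m * h - b) (real m * (real n * h - g) - (real n * b - k)) s t = 0"
  shows "minus_cf (1 / (real m - s)) \<and> minus_cf (1 / (real n - t))
    \<and> curve k b g h (1 / (real m - s)) (1 / (real n - t)) = 0"
proof -
  note s = minus_cf_bounds[OF assms(1)] and t = minus_cf_bounds[OF assms(2)]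
  have ne: "real m \<noteq> s" "real n \<noteq> t" using s t assms(3,4) by linarith+
  then have "curve k b g h (1 / (real m - s)) (1 / (real n - t)) = 0"
    using curve_split_both[OF ne, of h g b k] assms(5) by simp
  then show ?thesis
    using minus_cf.intros[OF assms(1) s assms(3)] minus_cf.intros[OF assms(2) t assms(4)] by blast
qed

section \<open>The initial curves\<close>

lemma unit_curve_solution:
  assumes w: "3/10 \<le> w" "w \<le> 1/2"
  shows "\<exists>s t. minus_cf s \<and> minus_cf t \<and> curve 1 1 1 w s t = 0"
proof -
  have both: ?thesis if mn: "3 \<le> m" "3 \<le> n"
    and R: "region w (real n * w - 1) (real m * w - 1) (real m * (real n * w - 1) - (real n * 1 - 1))" for m n
  proof -
    obtain s t where "minus_cf s" "minus_cf t"
      "curve w (real n * w - 1) (real m * w - 1) (real m * (real n * w - 1) - (real n * 1 - 1)) s t = 0"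
      using region_solution[OF R] by blast
    from solution_split_both[OF this(1,2) mn this(3)] show ?thesis by blast
  qed
  \<comment> \<open>No single pair of digits leads into the cone for \<open>w\<close> between \<open>0.433\<close> and \<open>0.446\<close>.\<close>
  have left_both: ?thesis if n: "3 \<le> n"
    and R: "region (3 * w - 1) (3 * (real n * w - 1) - (real n * 1 - 1)) (3 * (3 * w - 1) - w)
      (3 * (3 * (real n * w - 1) - (real n * 1 - 1)) - (real n * w - 1))" for n
  proof -
    obtain s t where st: "minus_cf s" "minus_cf t"
      "curve (3 * w - 1) (3 * (real n * w - 1) - (real n * 1 - 1)) (3 * (3 * w - 1) - w)
        (3 * (3 * (real n * w - 1) - (real n * 1 - 1)) - (real n * w - 1)) s t = 0"
      using region_solution[OF R] by blast
    \<comment> \<open>The first coordinate begins with the digits 3, 3 and the second with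
      \<open>n\<close>.\<close>
    define s' where "s' = 1 / (real 3 - s)"
    have s': "minus_cf s'" "curve w (real n * w - 1) (real 3 * w - 1)
        (real 3 * (real n * w - 1) - (real n * 1 - 1)) s' t = 0"
      using solution_split_left[OF st(1), of 3 "3 * w - 1" "3 * (real n * w - 1) - (real n * 1 - 1)" w
          "real n * w - 1" t] st(3) by (simp_all add: s'_def)
    from solution_split_both[OF s'(1) st(2) order_refl n s'(2)] show ?thesis by blast
  qed
  \<comment> \<open>The symmetric curve violates 8 q <= 5 p, so it is not in the cone itself. On
    each range of \<open>w\<close>, fixed first digits lead into the cone by inequalities linear in
    \<open>w\<close>.\<close>
  consider "w \<le> 61/200"
    | "61/200 \<le> w" "w \<le> 317/1000"
    | "317/1000 \<le> w" "w \<le> 3347/10000"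
    | "3347/10000 \<le> w" "w \<le> 346/1000"
    | "346/1000 \<le> w" "w \<le> 36/100"
    | "36/100 \<le> w" "w \<le> 38/100"
    | "38/100 \<le> w" "w \<le> 403/1000"
    | "403/1000 \<le> w" "w \<le> 4325/10000"
    | "4325/10000 \<le> w" "w \<le> 439/1000"
    | "439/1000 \<le> w" "w \<le> 445/1000"
    | "445/1000 \<le> w" "w \<le> 45/100"
    | "45/100 \<le> w" "w \<le> 47/100"
    | "47/100 \<le> w"
    using linear[of w "61/200"] linear[of w "317/1000"] linear[of w "3347/10000"] linear[of
      w "346/1000"] linear[of w "36/100"] linear[of w "38/100"] linear[of w "403/1000"]
      linear[of w "4325/10000"] linear[of w "439/1000"] linear[of w "445/1000"] linear[of
      w "45/100"] linear[of w "47/100"]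
    by blast
  then show ?thesis
  proof cases
    case 1
    then show ?thesis using w by (intro both[of 5 9]) (simp_all add: region_def)
  next
    case 2
    then show ?thesis using w by (intro both[of 5 8]) (simp_all add: region_def)
  next
    case 3
    then show ?thesis using w by (intro both[of 5 7]) (simp_all add: region_def)
  next
    case 4
    then show ?thesis using w by (intro both[of 4 9]) (simp_all add: region_def)
  next
    case 5
    then show ?thesis using w by (intro both[of 4 8]) (simp_all add: region_def)
  next
    case 6
    then show ?thesis using w by (intro both[of 4 7]) (simp_all add: region_def)
  next
    case 7
    then show ?thesis using w by (intro both[of 4 6]) (simp_all add: region_def)
  next
    case 8
    then show ?thesis using w by (intro both[of 4 5]) (simp_all add: region_def)
  next
    case 9
    then show ?thesis using w by (intro left_both[of 11]) (simp_all add: region_def)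
  next
    case 10
    then show ?thesis using w by (intro left_both[of 10]) (simp_all add: region_def)
  next
    case 11
    then show ?thesis using w by (intro left_both[of 9]) (simp_all add: region_def)
  next
    case 12
    then show ?thesis using w by (intro both[of 3 6]) (simp_all add: region_def)
  next
    case 13
    then show ?thesis using w by (intro both[of 3 5]) (simp_all add: region_def)
  qed
qed

text \<open>For small \<open>w\<close> the lattice point argument enters the cone at once. Its
  failure forces \<open>w\<close> to be at least 3/10 and \<open>l\<close> to be 0 or 1; for
  \<open>l = 1\<close> the curve already lies in the cone.\<close>

lemma unit_fraction_solution:
  assumes w: "0 < w" "w \<le> 1/2"
  shows "\<exists>s t. minus_cf s \<and> minus_cf t \<and> curve 1 (real l + 1) 1 w s t = 0"
proof (cases "625 * w\<^sup>2 \<le> 81 * ((real l + 1) * 1 - 1 * w)")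
  case True
  have l1: "1 \<le> real l + 1" by simp
  obtain m n :: nat where mn: "3 \<le> m" "3 \<le> n"
    and "real m * w \<le> 2 * (real l + 1) + 1 + w" "real n * w \<le> 2 * (real l + 1) + 3 * 1 + w"
    and R: "region w (real n * w - 1) (real m * w - (real l + 1))
      (real m * (real n * w - 1) - (real n * (real l + 1) - 1))"
    by (rule small_region[OF zero_le_one zero_less_one l1 w(1) True])
  obtain s t where "minus_cf s" "minus_cf t" "curve w (real n * w - 1) (real m * w - (real l + 1))
      (real m * (real n * w - 1) - (real n * (real l + 1) - 1)) s t = 0"
    using region_solution[OF R] by blast
  from solution_split_both[OF this(1,2) mn this(3)] show ?thesis by blast
next
  case False
  have w2: "w\<^sup>2 \<le> w / 2" using w by (simp add: power2_eq_square mult_left_le)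
  have w3: "3/10 \<le> w"
  proof (rule ccontr)
    assume "\<not> 3/10 \<le> w"
    then have "w\<^sup>2 \<le> (3/10)\<^sup>2" using w by (intro power_mono) auto
    then show False using False \<open>\<not> 3/10 \<le> w\<close> by (simp add: power2_eq_square)
  qed
  have "real l < 2" using False w w2 by simp
  then consider "l = 0" | "l = 1" by force
  then show ?thesis
  proof cases
    case 1
    then show ?thesis using unit_curve_solution[OF w3 w(2)] by simp
  next
    case 2
    then have "region 1 (real l + 1) 1 w" using w w3 by (simp add: region_def)
    then show ?thesis by (rule region_solution)
  qed
qed

text \<open>Used for integers \<open>x\<close>: a fraction of length one has no odd index.\<close>

lemma regular_cf_of_nat: "regular_cf (\<lambda>_. p) 0 (real p) \<and> odd_quotients_one (\<lambda>_. p) 0"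
  by (auto simp: regular_cf_def odd_quotients_one_def zero_enat_def)

theorem theorem1p2:
  fixes x :: real
  assumes "x > 0"
    and "x \<in> {of_int k + t | (k :: int) (t :: real). t \<in> {1/2..1}}"
  shows "\<exists>(a :: nat \<Rightarrow> nat) (M :: enat) (b :: nat \<Rightarrow> nat) (N :: enat) (u :: real) (v :: real).
           regular_cf a M u \<and> odd_quotients_one a M \<and>
           regular_cf b N v \<and> odd_quotients_one b N \<and>
           x = u * v"
proof -
  obtain k :: int and t where kt: "x = of_int k + t" "1/2 \<le> t" "t \<le> 1" using assms(2) by auto
  have "0 \<le> k" using assms(1) kt by linarith
  then obtain l where l: "k = int l" using nonneg_int_cases by blast
  show ?thesis
  proof (cases "t = 1")
    case True
    then have "x = real (Suc l) * real 1" using kt l by simp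
    then show ?thesis using regular_cf_of_nat by blast
  next
    case False
    define w where "w = 1 - t"
    have w: "0 < w" "w \<le> 1/2" using kt False by (simp_all add: w_def)
    obtain s s' where s: "minus_cf s" "minus_cf s'" "curve 1 (real l + 1) 1 w s s' = 0"
      using unit_fraction_solution[OF w] by blast
    \<comment> \<open>Expanding the product gives l + 1 - w, because (s, s') lies on the
      curve.\<close>
    have "x = (real (Suc 0) - s) * (real (Suc l) - s')"
      using s(3) kt l by (simp add: curve_def w_def algebra_simps)
    then show ?thesis using minus_cf_regular[OF s(1)] minus_cf_regular[OF s(2)] by blast
  qed
qed

end
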